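(* Assume [H0], [H1], [H2] and [H3] (as listed in the context). Let $u:\mathcal S\to\mathbb R$ be a bounded continuous viscosity subsolution of (HJ), and let $v:\mathcal S\to\mathbb R$ be a bounded viscosity supersolution of (HJ). Then $u\le v$ in $\mathcal S$.
   Context: **Geometry.** In $\mathbb R^3$ with Euclidean scalar product $x\cdot y$ and norm $|x|$, let $N>1$ and let $e_0,e_1,\dots,e_N$ be distinct unit vectors with $e_i\cdot e_0=0$ for $i=1,\dots,N$. Write $\mathbb R e_0\times\mathbb R e_i$ for the plane spanned by $e_0,e_i$. Let $\mathcal P_i=\{x_0e_0+x_ie_i: x_0\in\mathbb R,\ x_i\ge 0\}$ (closed half-plane), $\Gamma=\mathbb R e_0$, $\mathcal S=\bigcup_{i=1}^N\mathcal P_i$. **Assumptions.** $A$ is a metric space and $\lambda>0$. [H0] For $i=1,\dots,N$, $A_i\subset A$ is non-empty and compact, the $A_i$ are pairwise disjoint, $f_i:\mathcal P_i\times A_i\to\mathbb R e_0\times\mathbb R e_i$ is continuous and bounded, and there is $L_f>0$ with $|f_i(x,a)-f_i(y,a)|\le L_f|x-y|$ for all $i$, $x,y\in\mathcal P_i$, $a\in A_i$. [H1] For $i=1,\dots,N$, $\ell_i:\mathcal P_i\times A_i\to\mathbb R$ is continuous and bounded, and there is a modulus of continuity $\omega_\ell$ with $|\ell_i(x,a)-\ell_i(y,a)|\le\omega_\ell(|x-y|)$ for all $i$, $x,y\in\mathcal P_i$, $a\in A_i$. [H2] For all $i$ and $x\in\mathcal P_i$, the set $\mathrm{FL}_i(x)=\{(f_i(x,a),\ell_i(x,a)):a\in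 A_i\}$ is convex (it is non-empty and closed). [H3] There is $\delta>0$ such that for all $i$ and $x\in\Gamma$, $B(0,\delta)\cap(\mathbb R e_0\times\mathbb R e_i)\subset\{f_i(x,a):a\in A_i\}$. **Viscosity sub/supersolutions.** $\mathcal R(\mathcal S)$ is the set of continuous $\varphi:\mathcal S\to\mathbb R$ with $\varphi|_{\mathcal P_j}\in C^1(\mathcal P_j)$ (up to the boundary $\Gamma$) for every $j$; $D(\varphi|_{\mathcal P_j})(x)\in\mathbb R e_0\times\mathbb R e_j$ is the gradient (for $x\in\Gamma$, the limit of gradients from $\mathcal P_j\setminus\Gamma$). Let $H_i(x,p)=\max_{a\in A_i}(-p\cdot f_i(x,a)-\ell_i(x,a))$ for $x\in\mathcal P_i$, $p\in\mathbb R e_0\times\mathbb R e_i$; for $x\in\Gamma$, $H_i^+(x,p)=\max_{a\in A_i,\ f_i(x,a)\cdot e_i\ge0}(-p\cdot f_i(x,a)-\ell_i(x,a))$ and $H_\Gamma(x,p_1,\dots,p_N)=\max_iH_i^+(x,p_i)$. (HJ) denotes the equation $\lambda u+H_i(x,Du)=0$ in $\mathcal P_i\setminus\Gamma$ ($i=1,\dots,N$), $\lambda u+H_\Gamma(x,D(u|_{\mathcal P_1}),\dots,D(u|_{\mathcal P_N}))=0$ on $\Gamma$, in the following sense. An upper semicontinuous $u:\mathcal S\to\mathbb R$ is a viscosity subsolution if, for every $x\in\mathcal S$ and $\varphi\in\mathcal R(\mathcal S)$ such that $u-\varphi$ has a local maximum (on $\mathcal S$) at $x$: $\lambda u(x)+H_i(x,D(\varphi|_{\mathcal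 P_i})(x))\le0$ if $x\in\mathcal P_i\setminus\Gamma$, and $\lambda u(x)+H_\Gamma(x,D(\varphi|_{\mathcal P_1})(x),\dots,D(\varphi|_{\mathcal P_N})(x))\le0$ if $x\in\Gamma$. A lower semicontinuous $u$ is a viscosity supersolution if the reverse inequalities ($\ge0$) hold whenever $u-\varphi$ has a local minimum at $x$. *)

theory Defs
  imports "HOL-Analysis.Analysis"
begin

definition ramified_frame :: "nat \<Rightarrow> (nat \<Rightarrow> real^3) \<Rightarrow> bool" where
  "ramified_frame N e \<longleftrightarrow> N > 1 \<and> inj_on e {0..N} \<and> (\<forall>i\<in>{0..N}. norm (e i) = 1) \<and>
     (\<forall>i\<in>{1..N}. e i \<bullet> e 0 = 0)"

definition plane :: "(nat \<Rightarrow> real^3) \<Rightarrow> nat \<Rightarrow> (real^3) set" where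
  "plane e i = span {e 0, e i}"

definition halfplane :: "(nat \<Rightarrow> real^3) \<Rightarrow> nat \<Rightarrow> (real^3) set" where
  "halfplane e i = {s *\<^sub>R e 0 + t *\<^sub>R e i | s t. t \<ge> 0}"

definition interface :: "(nat \<Rightarrow> real^3) \<Rightarrow> (real^3) set" where
  "interface e = span {e 0}"

definition ramified_space :: "nat \<Rightarrow> (nat \<Rightarrow> real^3) \<Rightarrow> (real^3) set" where
  "ramified_space N e = (\<Union>i\<in>{1..N}. halfplane e i)"

definition H0 :: "nat \<Rightarrow> (nat \<Rightarrow> real^3) \<Rightarrow> (nat \<Rightarrow> 'a::metric_space set) \<Rightarrow>
    (nat \<Rightarrow> real^3 \<Rightarrow> 'a \<Rightarrow> real^3) \<Rightarrow> bool" where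
  "H0 N e A f \<longleftrightarrow>
     (\<forall>i\<in>{1..N}. A i \<noteq> {} \<and> compact (A i)) \<and>
     (\<forall>i\<in>{1..N}. \<forall>j\<in>{1..N}. i \<noteq> j \<longrightarrow> A i \<inter> A j = {}) \<and>
     (\<forall>i\<in>{1..N}. \<forall>x\<in>halfplane e i. \<forall>a\<in>A i. f i x a \<in> plane e i) \<and>
     (\<forall>i\<in>{1..N}. continuous_on (halfplane e i \<times> A i) (\<lambda>(x, a). f i x a)) \<and>
     (\<forall>i\<in>{1..N}. bounded ((\<lambda>(x, a). f i x a) ` (halfplane e i \<times> A i))) \<and>
     (\<exists>L>0. \<forall>i\<in>{1..N}. \<forall>x\<in>halfplane e i. \<forall>y\<in>halfplane e i. \<forall>a\<in>A i.
        norm (f i x a - f i y a) \<le> L * norm (x - y))"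

text \<open>Only the values of a modulus on the half-line \<open>[0, \<infinity>)\<close> matter.\<close>

definition modulus_of_continuity :: "(real \<Rightarrow> real) \<Rightarrow> bool" where
  "modulus_of_continuity \<omega> \<longleftrightarrow> \<omega> 0 = 0 \<and> (\<forall>t\<ge>0. \<omega> t \<ge> 0) \<and> mono_on {0..} \<omega> \<and>
     (\<omega> \<longlongrightarrow> 0) (at_right 0)"

definition H1 :: "nat \<Rightarrow> (nat \<Rightarrow> real^3) \<Rightarrow> (nat \<Rightarrow> 'a::metric_space set) \<Rightarrow>
    (nat \<Rightarrow> real^3 \<Rightarrow> 'a \<Rightarrow> real) \<Rightarrow> bool" where
  "H1 N e A l \<longleftrightarrow>
     (\<forall>i\<in>{1..N}. continuous_on (halfplane e i \<times> A i) (\<lambda>(x, a). l i x a)) \<and>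
     (\<forall>i\<in>{1..N}. bounded ((\<lambda>(x, a). l i x a) ` (halfplane e i \<times> A i))) \<and>
     (\<exists>\<omega>. modulus_of_continuity \<omega> \<and>
        (\<forall>i\<in>{1..N}. \<forall>x\<in>halfplane e i. \<forall>y\<in>halfplane e i. \<forall>a\<in>A i.
           \<bar>l i x a - l i y a\<bar> \<le> \<omega> (norm (x - y))))"

definition FL :: "(nat \<Rightarrow> 'a set) \<Rightarrow> (nat \<Rightarrow> real^3 \<Rightarrow> 'a \<Rightarrow> real^3) \<Rightarrow>
    (nat \<Rightarrow> real^3 \<Rightarrow> 'a \<Rightarrow> real) \<Rightarrow> nat \<Rightarrow> real^3 \<Rightarrow> ((real^3) \<times> real) set" where
  "FL A f l i x = {(f i x a, l i x a) | a. a \<in> A i}"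

definition H2 :: "nat \<Rightarrow> (nat \<Rightarrow> real^3) \<Rightarrow> (nat \<Rightarrow> 'a set) \<Rightarrow>
    (nat \<Rightarrow> real^3 \<Rightarrow> 'a \<Rightarrow> real^3) \<Rightarrow> (nat \<Rightarrow> real^3 \<Rightarrow> 'a \<Rightarrow> real) \<Rightarrow> bool" where
  "H2 N e A f l \<longleftrightarrow> (\<forall>i\<in>{1..N}. \<forall>x\<in>halfplane e i. convex (FL A f l i x))"

definition H3 :: "nat \<Rightarrow> (nat \<Rightarrow> real^3) \<Rightarrow> (nat \<Rightarrow> 'a set) \<Rightarrow>
    (nat \<Rightarrow> real^3 \<Rightarrow> 'a \<Rightarrow> real^3) \<Rightarrow> bool" where
  "H3 N e A f \<longleftrightarrow>
     (\<exists>\<delta>>0. \<forall>i\<in>{1..N}. \<forall>x\<in>interface e. ball 0 \<delta> \<inter> plane e i \<subseteq> {f i x a | a. a \<in> A i})"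

text \<open>The suprema are maxima under the standing assumptions: see the lemmas
  \<open>Ham_attained\<close> and \<open>Ham_plus_attained\<close> below.\<close>

definition Ham :: "(nat \<Rightarrow> 'a set) \<Rightarrow> (nat \<Rightarrow> real^3 \<Rightarrow> 'a \<Rightarrow> real^3) \<Rightarrow>
    (nat \<Rightarrow> real^3 \<Rightarrow> 'a \<Rightarrow> real) \<Rightarrow> nat \<Rightarrow> real^3 \<Rightarrow> real^3 \<Rightarrow> real" where
  "Ham A f l i x p = (SUP a\<in>A i. - (p \<bullet> f i x a) - l i x a)"

definition Ham_plus :: "(nat \<Rightarrow> real^3) \<Rightarrow> (nat \<Rightarrow> 'a set) \<Rightarrow>
    (nat \<Rightarrow> real^3 \<Rightarrow> 'a \<Rightarrow> real^3) \<Rightarrow> (nat \<Rightarrow> real^3 \<Rightarrow> 'a \<Rightarrow> real) \<Rightarrow>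
    nat \<Rightarrow> real^3 \<Rightarrow> real^3 \<Rightarrow> real" where
  "Ham_plus e A f l i x p = (SUP a\<in>{a \<in> A i. f i x a \<bullet> e i \<ge> 0}. - (p \<bullet> f i x a) - l i x a)"

definition Ham_interface :: "nat \<Rightarrow> (nat \<Rightarrow> real^3) \<Rightarrow> (nat \<Rightarrow> 'a set) \<Rightarrow>
    (nat \<Rightarrow> real^3 \<Rightarrow> 'a \<Rightarrow> real^3) \<Rightarrow> (nat \<Rightarrow> real^3 \<Rightarrow> 'a \<Rightarrow> real) \<Rightarrow>
    real^3 \<Rightarrow> (nat \<Rightarrow> real^3) \<Rightarrow> real" where
  "Ham_interface N e A f l x p = (MAX i\<in>{1..N}. Ham_plus e A f l i x (p i))"

lemma continuous_on_slice:
  assumes "continuous_on (P \<times> C) (\<lambda>(x, a). g x a)" "x \<in> P" "B \<subseteq> C"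
  shows "continuous_on B (\<lambda>a. g x a)"
proof -
  have "continuous_on B (\<lambda>a. (\<lambda>(x, a). g x a) (x, a))"
    using assms by (intro continuous_on_compose2[OF assms(1)] continuous_intros) auto
  then show ?thesis by simp
qed

lemma Ham_attained_on:
  assumes "H0 N e A f" "H1 N e A l" "i \<in> {1..N}" "x \<in> halfplane e i"
    and B: "B \<noteq> {}" "compact B" "B \<subseteq> A i"
  shows "\<exists>a\<in>B. (SUP a\<in>B. - (p \<bullet> f i x a) - l i x a) = - (p \<bullet> f i x a) - l i x a"
proof -
  let ?g = "\<lambda>a. - (p \<bullet> f i x a) - l i x a"
  have cf: "continuous_on B (\<lambda>a. f i x a)"
    using assms unfolding H0_def by (intro continuous_on_slice[of "halfplane e i" "A i" "f i"]) auto
  have cl: "continuous_on B (\<lambda>a. l i x a)"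
    using assms unfolding H1_def by (intro continuous_on_slice[of "halfplane e i" "A i" "l i"]) auto
  have "continuous_on B ?g"
    by (intro continuous_intros cf cl)
  then obtain a where a: "a \<in> B" "\<forall>b\<in>B. ?g b \<le> ?g a"
    using continuous_attains_sup[of B ?g] B by blast
  have "(SUP a\<in>B. ?g a) = ?g a"
    using a by (intro cSup_eq_maximum) auto
  then show ?thesis using a(1) by blast
qed

lemma Ham_attained:
  assumes "H0 N e A f" "H1 N e A l" "i \<in> {1..N}" "x \<in> halfplane e i"
  shows "\<exists>a\<in>A i. Ham A f l i x p = - (p \<bullet> f i x a) - l i x a"
  unfolding Ham_def using assms by (intro Ham_attained_on[OF assms]) (auto simp: H0_def)

lemma interface_subset_halfplane: "interface e \<subseteq> halfplane e i"
proof
  fix x assume "x \<in> interface e"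
  then obtain s where "x = s *\<^sub>R e 0" by (auto simp: interface_def span_singleton)
  then have "x = s *\<^sub>R e 0 + 0 *\<^sub>R e i \<and> (0::real) \<ge> 0" by simp
  then show "x \<in> halfplane e i" unfolding halfplane_def by blast
qed

lemma Ham_plus_attained:
  assumes "H0 N e A f" "H1 N e A l" "H3 N e A f" "i \<in> {1..N}" "x \<in> interface e"
  shows "\<exists>a\<in>A i. f i x a \<bullet> e i \<ge> 0 \<and> Ham_plus e A f l i x p = - (p \<bullet> f i x a) - l i x a"
proof -
  let ?B = "{a \<in> A i. f i x a \<bullet> e i \<ge> 0}"
  have x: "x \<in> halfplane e i" using interface_subset_halfplane assms(5) by blast
  have A: "compact (A i)" using assms by (auto simp: H0_def)
  obtain \<delta> where "\<delta> > 0" "ball 0 \<delta> \<inter> plane e i \<subseteq> {f i x a | a. a \<in> A i}"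
    using assms unfolding H3_def by blast
  moreover have "0 \<in> plane e i" by (simp add: plane_def span_zero)
  ultimately have "0 \<in> {f i x a | a. a \<in> A i}" by (meson IntI centre_in_ball subsetD)
  then obtain a where "a \<in> A i" "f i x a = 0" by auto
  then have ne: "?B \<noteq> {}" by force
  have "continuous_on (A i) (\<lambda>a. f i x a)"
    using assms x unfolding H0_def
    by (intro continuous_on_slice[of "halfplane e i" "A i" "f i"]) auto
  then have "continuous_on (A i) (\<lambda>a. f i x a \<bullet> e i)" by (intro continuous_intros)
  then have "closed (A i \<inter> (\<lambda>a. f i x a \<bullet> e i) -` {0..})"
    using A by (intro continuous_closed_preimage) (auto intro: compact_imp_closed)
  then have "compact (A i \<inter> (A i \<inter> (\<lambda>a. f i x a \<bullet> e i) -` {0..}))"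
    using A compact_Int_closed by blast
  moreover have "A i \<inter> (A i \<inter> (\<lambda>a. f i x a \<bullet> e i) -` {0..}) = ?B" by auto
  ultimately have "compact ?B" by simp
  then show ?thesis
    using Ham_attained_on[OF assms(1,2,4) x ne, of p] unfolding Ham_plus_def by auto
qed

text \<open>Functions on the ramified space are total functions of which only the values on
  that space are used. A vector \<open>p\<close> of the plane of index \<open>i\<close> is the gradient of
  \<open>\<phi>\<close>, restricted to the half-plane of index \<open>i\<close>, at an inner point \<open>x\<close> if
  \<open>h \<mapsto> p \<bullet> h\<close> is a derivative of \<open>\<phi>\<close> at \<open>x\<close> within this half-plane. Membership
  in the plane makes \<open>p\<close> unique: see \<open>is_inner_gradient_unique\<close> below.\<close>

definition is_inner_gradient ::
    "(nat \<Rightarrow> real^3) \<Rightarrow> nat \<Rightarrow> (real^3 \<Rightarrow> real) \<Rightarrow> real^3 \<Rightarrow> real^3 \<Rightarrow> bool" where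
  "is_inner_gradient e i \<phi> x p \<longleftrightarrow> p \<in> plane e i \<and>
     (\<phi> has_derivative (\<lambda>h. p \<bullet> h)) (at x within halfplane e i)"

definition inner_gradient ::
    "(nat \<Rightarrow> real^3) \<Rightarrow> nat \<Rightarrow> (real^3 \<Rightarrow> real) \<Rightarrow> real^3 \<Rightarrow> real^3" where
  "inner_gradient e i \<phi> x = (THE p. is_inner_gradient e i \<phi> x p)"

definition gradient ::
    "(nat \<Rightarrow> real^3) \<Rightarrow> nat \<Rightarrow> (real^3 \<Rightarrow> real) \<Rightarrow> real^3 \<Rightarrow> real^3" where
  "gradient e i \<phi> x =
     (if x \<in> interface e
      then Lim (at x within halfplane e i - interface e) (inner_gradient e i \<phi>)
      else inner_gradient e i \<phi> x)"

text \<open>\<open>C\<^sup>1\<close> up to the boundary: differentiable inside, with a gradient that extends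
  continuously to the whole closed half-plane.\<close>

definition C1_halfplane :: "(nat \<Rightarrow> real^3) \<Rightarrow> nat \<Rightarrow> (real^3 \<Rightarrow> real) \<Rightarrow> bool" where
  "C1_halfplane e i \<phi> \<longleftrightarrow>
     continuous_on (halfplane e i) \<phi> \<and>
     (\<forall>x\<in>halfplane e i - interface e. \<exists>p. is_inner_gradient e i \<phi> x p) \<and>
     (\<forall>x\<in>interface e. \<exists>p. (inner_gradient e i \<phi> \<longlongrightarrow> p) (at x within halfplane e i - interface e)) \<and>
     continuous_on (halfplane e i) (gradient e i \<phi>)"

definition test_functions :: "nat \<Rightarrow> (nat \<Rightarrow> real^3) \<Rightarrow> (real^3 \<Rightarrow> real) set" where
  "test_functions N e =
     {\<phi>. continuous_on (ramified_space N e) \<phi> \<and> (\<forall>j\<in>{1..N}. C1_halfplane e j \<phi>)}"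

lemma is_inner_gradient_unique:
  assumes fr: "ramified_frame N e" "i \<in> {1..N}" and x: "x \<in> halfplane e i - interface e"
    and p: "is_inner_gradient e i \<phi> x p" and q: "is_inner_gradient e i \<phi> x q"
  shows "p = q"
proof -
  obtain s t where st: "x = s *\<^sub>R e 0 + t *\<^sub>R e i" "t \<ge> 0"
    using x by (auto simp: halfplane_def)
  have "t \<noteq> 0" using x st by (auto simp: interface_def span_singleton)
  then have t: "t > 0" using st by simp
  have dir: "p \<bullet> (a *\<^sub>R e 0 + b *\<^sub>R e i) = q \<bullet> (a *\<^sub>R e 0 + b *\<^sub>R e i)" if "\<bar>b\<bar> \<le> t" for a b
  proof -
    let ?h = "a *\<^sub>R e 0 + b *\<^sub>R e i" and ?\<gamma> = "\<lambda>r::real. x + r *\<^sub>R (a *\<^sub>R e 0 + b *\<^sub>R e i)"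
    have inP: "?\<gamma> ` {-1..1} \<subseteq> halfplane e i"
    proof clarify
      fix r :: real assume r: "r \<in> {-1..1}"
      have "\<bar>r * b\<bar> \<le> 1 * t" unfolding abs_mult using r that by (intro mult_mono) auto
      then have "t + r * b \<ge> 0" by linarith
      moreover have "?\<gamma> r = (s + r * a) *\<^sub>R e 0 + (t + r * b) *\<^sub>R e i"
        by (simp add: st algebra_simps)
      ultimately show "?\<gamma> r \<in> halfplane e i" unfolding halfplane_def by blast
    qed
    have d: "((\<phi> \<circ> ?\<gamma>) has_real_derivative v \<bullet> ?h) (at 0)" if v: "is_inner_gradient e i \<phi> x v" for v
    proof -
      have "(?\<gamma> has_derivative (\<lambda>r. r *\<^sub>R ?h)) (at 0 within {-1..1})"
        by (auto intro!: derivative_eq_intros)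
      moreover have "(\<phi> has_derivative (\<lambda>h. v \<bullet> h)) (at (?\<gamma> 0) within ?\<gamma> ` {-1..1})"
        using v inP has_derivative_subset unfolding is_inner_gradient_def by auto
      ultimately have "((\<phi> \<circ> ?\<gamma>) has_derivative ((\<lambda>h. v \<bullet> h) \<circ> (\<lambda>r. r *\<^sub>R ?h))) (at 0 within {-1..1})"
        by (rule diff_chain_within)
      moreover have "at (0::real) within {-1..1} = at 0"
        by (intro at_within_interior) (auto simp: interior_atLeastAtMost_real)
      ultimately show ?thesis
        by (simp add: has_field_derivative_def o_def mult.commute[of _ "v \<bullet> ?h"] mult_commute_abs)
    qed
    show ?thesis using DERIV_unique[OF d[OF p] d[OF q]] .
  qed
  have "p \<bullet> e 0 = q \<bullet> e 0" using dir[of 0 1] t by simp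
  moreover have "t * (p \<bullet> e i) = t * (q \<bullet> e i)" using dir[of t 0] t by simp
  ultimately have o: "(p - q) \<bullet> e 0 = 0" "(p - q) \<bullet> e i = 0" using t by (auto simp: inner_diff_left)
  have "p - q \<in> span {e 0, e i}"
    using p q unfolding is_inner_gradient_def plane_def by (auto intro: span_diff)
  moreover have "orthogonal (p - q) y" if "y \<in> {e 0, e i}" for y
    using that o by (auto simp: orthogonal_def)
  ultimately have "orthogonal (p - q) (p - q)" by (meson orthogonal_to_span)
  then show ?thesis by (simp add: orthogonal_def)
qed

definition usc_on :: "(real^3) set \<Rightarrow> (real^3 \<Rightarrow> real) \<Rightarrow> bool" where
  "usc_on S u \<longleftrightarrow> (\<forall>x\<in>S. \<forall>c>u x. eventually (\<lambda>y. u y < c) (at x within S))"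

definition lsc_on :: "(real^3) set \<Rightarrow> (real^3 \<Rightarrow> real) \<Rightarrow> bool" where
  "lsc_on S u \<longleftrightarrow> (\<forall>x\<in>S. \<forall>c<u x. eventually (\<lambda>y. c < u y) (at x within S))"

definition local_max_on :: "(real^3) set \<Rightarrow> (real^3 \<Rightarrow> real) \<Rightarrow> real^3 \<Rightarrow> bool" where
  "local_max_on S g x \<longleftrightarrow> x \<in> S \<and> (\<exists>r>0. \<forall>y\<in>S \<inter> ball x r. g y \<le> g x)"

definition local_min_on :: "(real^3) set \<Rightarrow> (real^3 \<Rightarrow> real) \<Rightarrow> real^3 \<Rightarrow> bool" where
  "local_min_on S g x \<longleftrightarrow> x \<in> S \<and> (\<exists>r>0. \<forall>y\<in>S \<inter> ball x r. g x \<le> g y)"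

definition viscosity_subsolution :: "nat \<Rightarrow> (nat \<Rightarrow> real^3) \<Rightarrow> (nat \<Rightarrow> 'a set) \<Rightarrow>
    (nat \<Rightarrow> real^3 \<Rightarrow> 'a \<Rightarrow> real^3) \<Rightarrow> (nat \<Rightarrow> real^3 \<Rightarrow> 'a \<Rightarrow> real) \<Rightarrow> real \<Rightarrow>
    (real^3 \<Rightarrow> real) \<Rightarrow> bool" where
  "viscosity_subsolution N e A f l lam u \<longleftrightarrow>
     usc_on (ramified_space N e) u \<and>
     (\<forall>x\<in>ramified_space N e. \<forall>\<phi>\<in>test_functions N e.
        local_max_on (ramified_space N e) (\<lambda>y. u y - \<phi> y) x \<longrightarrow>
          (\<forall>i\<in>{1..N}. x \<in> halfplane e i - interface e \<longrightarrow>
             lam * u x + Ham A f l i x (gradient e i \<phi> x) \<le> 0) \<and>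
          (x \<in> interface e \<longrightarrow>
             lam * u x + Ham_interface N e A f l x (\<lambda>i. gradient e i \<phi> x) \<le> 0))"

definition viscosity_supersolution :: "nat \<Rightarrow> (nat \<Rightarrow> real^3) \<Rightarrow> (nat \<Rightarrow> 'a set) \<Rightarrow>
    (nat \<Rightarrow> real^3 \<Rightarrow> 'a \<Rightarrow> real^3) \<Rightarrow> (nat \<Rightarrow> real^3 \<Rightarrow> 'a \<Rightarrow> real) \<Rightarrow> real \<Rightarrow>
    (real^3 \<Rightarrow> real) \<Rightarrow> bool" where
  "viscosity_supersolution N e A f l lam u \<longleftrightarrow>
     lsc_on (ramified_space N e) u \<and>
     (\<forall>x\<in>ramified_space N e. \<forall>\<phi>\<in>test_functions N e.
        local_min_on (ramified_space N e) (\<lambda>y. u y - \<phi> y) x \<longrightarrow>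
          (\<forall>i\<in>{1..N}. x \<in> halfplane e i - interface e \<longrightarrow>
             lam * u x + Ham A f l i x (gradient e i \<phi> x) \<ge> 0) \<and>
          (x \<in> interface e \<longrightarrow>
             lam * u x + Ham_interface N e A f l x (\<lambda>i. gradient e i \<phi> x) \<ge> 0))"

end

theory Submission
  imports Defs
begin

text \<open>Suppose \<open>u - v\<close> is positive somewhere. Subtracting small quadratic terms, \<open>u - v\<close> has a strict
  maximum point \<open>xs\<close> with positive value. Off the interface the usual doubling of variables gives
  a contradiction. On the interface only the tangential variable is doubled, that is, \<open>x\<close> and \<open>y\<close>
  range over pairs with \<open>y - x\<close> in \<open>\<real> e\<^sub>0\<close>. If such a maximum lies off the interface, the normal
  variable is doubled as well; the resulting large normal gradients are harmless, because near the
  interface controllability bounds the gradients of test functions touching \<open>u\<close>. If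
  it lies on the interface, integrating the subsolution property of \<open>u\<close> along each constant
  direction \<open>f\<^sub>i(y, a)\<close> pointing into the half-plane of index \<open>i\<close> bounds \<open>v\<close> from below near \<open>y\<close>;
  the best of these bounds yields a slope \<open>r\<^sub>i\<close> such that the function with tangential slope \<open>p\<^sub>0\<close>
  and normal slopes \<open>r\<^sub>i\<close> touches \<open>v\<close> from below at \<open>y\<close> and contradicts the supersolution
  condition on the interface.\<close>

section \<open>Penalized maxima\<close>

text \<open>Penalizing the full distance fails at the interface: the two maximum points may lie in
  different half-planes, or only one of them on \<open>\<Gamma>\<close>, and then inequalities for
  different Hamiltonians would have to be compared. The constraint
  \<open>y - x \<in> \<Gamma>\<close> keeps both points in one half-plane at one height, but then
  \<open>u\<close> and \<open>v\<close> cannot be tested independently in the normal direction. That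
  information is recovered from \<open>u\<close>: controllability bounds its gradients, and its
  continuity carries estimates from the open half-planes to \<open>\<Gamma>\<close>, whereas
  \<open>v\<close> is only lower semicontinuous. The directions pointing into a half-plane are
  exactly those that enter \<open>Ham_plus\<close>, so bounds along them suffice to contradict the
  supersolution condition. All constants follow one budget: with \<open>Q = lam * \<mu>\<close>,
  every doubled maximum satisfies \<open>lam * (u x - v y) \<ge> Q\<close>, while the errors are
  arranged to add up to at most \<open>3 * Q / 4\<close>.\<close>

lemma usc_attains_max:
  fixes g :: "'b::metric_space \<Rightarrow> real"
  assumes "compact K" "K \<noteq> {}"
    and usc: "\<And>z c. z \<in> K \<Longrightarrow> g z < c \<Longrightarrow> eventually (\<lambda>y. g y < c) (at z within K)"
  shows "\<exists>z\<in>K. \<forall>y\<in>K. g y \<le> g z"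
proof (rule ccontr)
  assume "\<not> ?thesis"
  then have "\<forall>z\<in>K. \<exists>y\<in>K. g z < g y" by (auto simp: not_le)
  then obtain b where b: "\<And>z. z \<in> K \<Longrightarrow> b z \<in> K \<and> g z < g (b z)" by metis
  have "\<exists>U. open U \<and> z \<in> U \<and> (\<forall>y\<in>U \<inter> K. g y < g (b z))" if z: "z \<in> K" for z
  proof -
    obtain U where "open U" "z \<in> U" "\<forall>y\<in>U. y \<noteq> z \<longrightarrow> y \<in> K \<longrightarrow> g y < g (b z)"
      using usc[of z "g (b z)"] b[OF z] z unfolding eventually_at_topological by blast
    then show ?thesis using b[OF z] by (intro exI[of _ U]) auto
  qed
  then obtain U where U: "\<And>z. z \<in> K \<Longrightarrow> open (U z) \<and> z \<in> U z \<and> (\<forall>y\<in>U z \<inter> K. g y < g (b z))"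
    by metis
  obtain D where D: "D \<subseteq> K" "finite D" "K \<subseteq> (\<Union>z\<in>D. U z)"
    using compactE_image[OF \<open>compact K\<close>, of K U] U by blast
  then have "D \<noteq> {}" using \<open>K \<noteq> {}\<close> by auto
  let ?m = "Max ((\<lambda>z. g (b z)) ` D)"
  have "?m \<in> (\<lambda>z. g (b z)) ` D" using D \<open>D \<noteq> {}\<close> by (intro Max_in) auto
  then obtain z where z: "z \<in> D" "?m = g (b z)" by auto
  then have "b z \<in> K" using b D by auto
  then obtain w where w: "w \<in> D" "b z \<in> U w" using D by auto
  then have "g (b z) < g (b w)" using U D \<open>b z \<in> K\<close> by blast
  also have "\<dots> \<le> ?m" using D w by (intro Max_ge) auto
  finally show False using z by simp
qed

text \<open>Comparison with \<open>z0\<close> gives \<open>n * d z \<le> g z - g z0\<close> for a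
  maximum point \<open>z\<close> of \<open>g - n * d\<close>. As \<open>g\<close> is bounded above
  on \<open>K\<close>, cluster points satisfy \<open>d = 0\<close>; semicontinuity and strictness
  identify them with \<open>z0\<close>, and the same inequality then makes \<open>n * d z\<close>
  small. It is used for the full distance, for the distance of pairs differing tangentially, and for
  the normal difference alone.\<close>

lemma penalized_maximum:
  fixes g d :: "'b::metric_space \<Rightarrow> real"
  assumes K: "compact K" and z0: "z0 \<in> K" "d z0 = 0"
    and usc: "\<And>z c. z \<in> K \<Longrightarrow> g z < c \<Longrightarrow> eventually (\<lambda>y. g y < c) (at z within K)"
    and d: "continuous_on K d" "\<And>z. z \<in> K \<Longrightarrow> d z \<ge> 0"
    and strict: "\<And>z. z \<in> K \<Longrightarrow> d z = 0 \<Longrightarrow> z \<noteq> z0 \<Longrightarrow> g z < g z0"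
    and eps: "\<epsilon> > 0"
  shows "\<exists>n>0. \<exists>z\<in>K. (\<forall>y\<in>K. g y - n * d y \<le> g z - n * d z) \<and> dist z z0 < \<epsilon> \<and> n * d z < \<epsilon>"
proof -
  have ex: "\<exists>z\<in>K. \<forall>y\<in>K. g y - real n * d y \<le> g z - real n * d z" for n
  proof (rule usc_attains_max[OF K])
    show "K \<noteq> {}" using z0 by auto
    fix z c assume z: "z \<in> K" and c: "g z - real n * d z < c"
    define \<eta> where "\<eta> = (c - (g z - real n * d z)) / 2"
    then have \<eta>: "\<eta> > 0" "c = g z - real n * d z + 2 * \<eta>" using c by (simp_all add: field_simps)
    have "eventually (\<lambda>y. g y < g z + \<eta>) (at z within K)" using usc[OF z] \<eta> by simp
    moreover have "((\<lambda>y. real n * d y) \<longlongrightarrow> real n * d z) (at z within K)"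
      using d(1) z by (auto simp: continuous_on_def intro: tendsto_intros)
    then have "eventually (\<lambda>y. real n * d y > real n * d z - \<eta>) (at z within K)"
      using \<eta> by (intro order_tendstoD) auto
    ultimately show "eventually (\<lambda>y. g y - real n * d y < c) (at z within K)"
    proof eventually_elim
      case (elim y)
      then show ?case using \<eta>(2) by linarith
    qed
  qed
  obtain m where m: "m \<in> K" "\<And>y. y \<in> K \<Longrightarrow> g y \<le> g m"
    using usc_attains_max[OF K _ usc] z0 by blast
  from ex obtain z where z: "\<And>n. z n \<in> K"
      "\<And>n y. y \<in> K \<Longrightarrow> g y - real n * d y \<le> g (z n) - real n * d (z n)"
    by metis
  obtain w \<sigma> where w: "w \<in> K" "strict_mono \<sigma>" "(z \<circ> \<sigma>) \<longlonglongrightarrow> w"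
    using K z(1) unfolding compact_def by metis
  have low: "real n * d (z n) \<le> g (z n) - g z0" for n
    using z(2)[OF z0(1), of n] z0 by simp
  have "(\<lambda>n. d (z (\<sigma> n))) \<longlonglongrightarrow> d w"
    using continuous_on_tendsto_compose[OF d(1) w(3) w(1)] z(1) by (simp add: o_def)
  moreover have "(\<lambda>n. d (z (\<sigma> n))) \<longlonglongrightarrow> 0"
  proof (rule tendsto_sandwich)
    show "\<forall>\<^sub>F n in sequentially. 0 \<le> d (z (\<sigma> n))" using d(2) z(1) by simp
    show "\<forall>\<^sub>F n in sequentially. d (z (\<sigma> n)) \<le> (g m - g z0) * inverse (real n)"
    proof (rule eventually_sequentiallyI[of 1])
      fix n :: nat assume n: "n \<ge> 1"
      have "real n * d (z (\<sigma> n)) \<le> real (\<sigma> n) * d (z (\<sigma> n))"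
        using seq_suble[OF w(2), of n] d(2) z(1) by (intro mult_right_mono) auto
      also have "\<dots> \<le> g m - g z0" using low[of "\<sigma> n"] m(2)[OF z(1), of "\<sigma> n"] by linarith
      finally show "d (z (\<sigma> n)) \<le> (g m - g z0) * inverse (real n)"
        using n by (simp add: field_simps)
    qed
    show "(\<lambda>n. (g m - g z0) * inverse (real n)) \<longlonglongrightarrow> 0"
      using tendsto_mult[OF tendsto_const lim_inverse_n, of "g m - g z0"] by simp
  qed simp
  ultimately have dw: "d w = 0" by (rule LIMSEQ_unique)
  \<comment> \<open>The sequence may take the value \<open>w\<close> itself, about which
    semicontinuity on a punctured neighbourhood says nothing; there the assumption \<open>c\<close>
    applies.\<close>
  have ev: "eventually (\<lambda>n. g (z (\<sigma> n)) < c) sequentially" if c: "g w < c" for c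
  proof -
    obtain U where U: "open U" "w \<in> U" "\<forall>y\<in>U. y \<noteq> w \<longrightarrow> y \<in> K \<longrightarrow> g y < c"
      using usc[OF w(1) c] unfolding eventually_at_topological by blast
    have "eventually (\<lambda>n. z (\<sigma> n) \<in> U) sequentially"
      using topological_tendstoD[OF w(3) U(1,2)] by simp
    then show ?thesis using U(3) c z(1) by (elim eventually_mono) metis
  qed
  have "w = z0"
  proof (rule ccontr)
    assume "w \<noteq> z0"
    then have "g w < g z0" using strict w dw by blast
    from eventually_happens[OF ev[OF this]] obtain n where n: "g (z (\<sigma> n)) < g z0" by auto
    have "0 \<le> real (\<sigma> n) * d (z (\<sigma> n))" using d(2) z(1) by simp
    then show False using low[of "\<sigma> n"] n by linarith
  qed
  have "eventually (\<lambda>n. g (z (\<sigma> n)) < g w + \<epsilon>) sequentially" using ev eps by simp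
  moreover have "eventually (\<lambda>n. dist (z (\<sigma> n)) w < \<epsilon>) sequentially"
    using tendstoD[OF w(3) eps] by (simp add: o_def)
  moreover have "eventually (\<lambda>n::nat. n > 0) sequentially" by (rule eventually_gt_at_top)
  ultimately have "eventually (\<lambda>n. g (z (\<sigma> n)) < g w + \<epsilon> \<and> dist (z (\<sigma> n)) w < \<epsilon> \<and> n > 0) sequentially"
    by eventually_elim auto
  from eventually_happens[OF this] obtain n
    where n: "g (z (\<sigma> n)) < g w + \<epsilon>" "dist (z (\<sigma> n)) w < \<epsilon>" "n > 0" by auto
  have "\<sigma> n > 0" using seq_suble[OF w(2), of n] n by simp
  moreover have "real (\<sigma> n) * d (z (\<sigma> n)) < \<epsilon>" using low[of "\<sigma> n"] n(1) unfolding \<open>w = z0\<close> by linarith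
  ultimately show ?thesis using n z \<open>w = z0\<close>
    by (intro exI[of _ "real (\<sigma> n)"]) auto
qed

section \<open>Geometry and test functions\<close>

locale junction =
  fixes N :: nat and e :: "nat \<Rightarrow> real^3"
  assumes frame: "ramified_frame N e"
begin

definition J :: "nat set" where "J = {1..N}"

abbreviation "\<S> \<equiv> ramified_space N e"
abbreviation "\<P> \<equiv> halfplane e"
abbreviation "\<Gamma> \<equiv> interface e"

text \<open>The orthogonal projection onto the plane of index \<open>i\<close>. Membership in the
  plane becomes the equation \<open>proj i x = x\<close>, and gradients along the half-plane become
  projections of gradients in the whole space.\<close>

definition proj :: "nat \<Rightarrow> real^3 \<Rightarrow> real^3" where
  "proj i x = (x \<bullet> e 0) *\<^sub>R e 0 + (x \<bullet> e i) *\<^sub>R e i"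

lemma finite_J [simp]: "finite J" and J_nonempty: "J \<noteq> {}"
  using frame unfolding J_def ramified_frame_def by auto

lemma ramified_space_eq: "\<S> = (\<Union>i\<in>J. \<P> i)"
  unfolding ramified_space_def J_def ..

lemma inner_e [simp]:
  "e 0 \<bullet> e 0 = 1" "i \<in> J \<Longrightarrow> e i \<bullet> e i = 1"
  "i \<in> J \<Longrightarrow> e 0 \<bullet> e i = 0" "i \<in> J \<Longrightarrow> e i \<bullet> e 0 = 0"
  using frame unfolding ramified_frame_def J_def by (auto simp: norm_eq_1 inner_commute)

lemma mem_halfplane: "i \<in> J \<Longrightarrow> x \<in> \<P> i \<longleftrightarrow> proj i x = x \<and> x \<bullet> e i \<ge> 0"
proof
  assume i: "i \<in> J"
  show "proj i x = x \<and> x \<bullet> e i \<ge> 0" if "x \<in> \<P> i"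
    using that i unfolding halfplane_def by (auto simp: proj_def inner_add_left)
  show "x \<in> \<P> i" if "proj i x = x \<and> x \<bullet> e i \<ge> 0"
    using that unfolding halfplane_def proj_def by (metis (mono_tags, lifting) mem_Collect_eq)
qed

lemma mem_plane: "i \<in> J \<Longrightarrow> x \<in> plane e i \<longleftrightarrow> proj i x = x"
proof
  assume i: "i \<in> J"
  show "proj i x = x" if "x \<in> plane e i"
  proof -
    from that obtain s t where "x = s *\<^sub>R e 0 + t *\<^sub>R e i"
      unfolding plane_def span_insert span_singleton by (auto simp: algebra_simps)
    then show ?thesis using i by (simp add: proj_def inner_add_left)
  qed
  show "x \<in> plane e i" if "proj i x = x"
  proof -
    have "proj i x \<in> span {e 0, e i}"
      unfolding proj_def by (intro span_add span_mul span_base) auto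
    then show ?thesis unfolding plane_def that .
  qed
qed

lemma mem_interface: "x \<in> \<Gamma> \<longleftrightarrow> x = (x \<bullet> e 0) *\<^sub>R e 0"
proof -
  have "x = (x \<bullet> e 0) *\<^sub>R e 0" if "x = s *\<^sub>R e 0" for s using that by simp
  then show ?thesis unfolding interface_def span_singleton by blast
qed

lemma proj_inner: "i \<in> J \<Longrightarrow> proj i x \<bullet> y = x \<bullet> proj i y"
  by (simp add: proj_def inner_add_left inner_add_right inner_commute)

lemma proj_add: "proj i (x + y) = proj i x + proj i y"
  and proj_diff: "proj i (x - y) = proj i x - proj i y"
  and proj_scaleR: "proj i (c *\<^sub>R x) = c *\<^sub>R proj i x"
  by (simp_all add: proj_def inner_add_left inner_diff_left algebra_simps)

lemma proj_proj: "i \<in> J \<Longrightarrow> proj i (proj i x) = proj i x"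
  by (simp add: proj_def inner_add_left)

lemma bounded_linear_proj: "bounded_linear (proj i)"
  unfolding proj_def by (intro bounded_linear_intros)

lemma halfplane_interface: "i \<in> J \<Longrightarrow> x \<in> \<P> i \<Longrightarrow> x \<in> \<Gamma> \<longleftrightarrow> x \<bullet> e i = 0"
proof -
  assume i: "i \<in> J" "x \<in> \<P> i"
  then have x: "x = (x \<bullet> e 0) *\<^sub>R e 0 + (x \<bullet> e i) *\<^sub>R e i" by (simp add: mem_halfplane proj_def)
  have "x \<bullet> e i = 0" if "x = (x \<bullet> e 0) *\<^sub>R e 0"
    by (subst that) (use i in simp)
  moreover have "x = (x \<bullet> e 0) *\<^sub>R e 0" if "x \<bullet> e i = 0" using x that by simp
  ultimately show ?thesis unfolding mem_interface by blast
qed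

lemma interface_halfplane: "x \<in> \<Gamma> \<Longrightarrow> x \<in> \<P> i"
  using interface_subset_halfplane by blast

lemma interface_inner: "i \<in> J \<Longrightarrow> x \<in> \<Gamma> \<Longrightarrow> x \<bullet> e i = 0"
  using halfplane_interface interface_halfplane by blast

lemma halfplane_subset: "i \<in> J \<Longrightarrow> \<P> i \<subseteq> \<S>"
  unfolding ramified_space_eq by auto

text \<open>The signs matter, since \<open>e j\<close> may be \<open>- e i\<close> and the two
  planes then coincide. Equality of the normal parts gives equal coefficients by taking norms, and
  distinctness of the unit vectors makes them vanish.\<close>

lemma halfplane_Int:
  assumes "i \<in> J" "j \<in> J" "i \<noteq> j" "x \<in> \<P> i" "x \<in> \<P> j"
  shows "x \<in> \<Gamma>"
proof -
  have x: "x = proj i x" "x = proj j x" "x \<bullet> e i \<ge> 0" "x \<bullet> e j \<ge> 0"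
    using assms by (auto simp: mem_halfplane)
  then have eq: "(x \<bullet> e i) *\<^sub>R e i = (x \<bullet> e j) *\<^sub>R e j" unfolding proj_def by (metis add_left_cancel)
  have n: "norm (e i) = 1" "norm (e j) = 1" using assms by (auto simp: norm_eq_1)
  have "x \<bullet> e i = x \<bullet> e j" using arg_cong[OF eq, of norm] x n by simp
  moreover have "e i \<noteq> e j"
    using frame assms unfolding ramified_frame_def inj_on_def J_def by force
  ultimately have "x \<bullet> e i = 0" using eq by auto
  then show ?thesis using halfplane_interface assms by blast
qed

lemma continuous_on_proj [continuous_intros]:
  "continuous_on X g \<Longrightarrow> continuous_on X (\<lambda>x. proj i (g x))"
  unfolding proj_def by (intro continuous_intros)

lemma closed_halfplane: assumes "i \<in> J" shows "closed (\<P> i)"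
proof -
  have "\<P> i = {x. proj i x = x} \<inter> {x. x \<bullet> e i \<ge> 0}" using mem_halfplane assms by auto
  moreover have "closed {x. proj i x = x}" by (intro closed_Collect_eq continuous_intros)
  moreover have "closed {x. x \<bullet> e i \<ge> 0}" by (intro closed_Collect_le continuous_intros)
  ultimately show ?thesis by auto
qed

lemma closed_interface: "closed \<Gamma>"
  unfolding interface_def by (simp add: closed_subspace)

lemma closed_ramified_space: "closed \<S>"
  unfolding ramified_space_eq using closed_halfplane by (intro closed_UN) auto

text \<open>The other half-planes are finitely many closed sets missing \<open>x\<close>. Hence off
  the interface an extremum relative to one half-plane is an extremum relative to the ramified
  space.\<close>

lemma interior_halfplane:
  assumes "i \<in> J" "x \<in> \<P> i" "x \<bullet> e i > 0"
  shows "\<exists>r>0. \<S> \<inter> ball x r \<subseteq> \<P> i"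
proof -
  let ?C = "\<Union>j\<in>J-{i}. \<P> j"
  have "closed ?C" using closed_halfplane by (intro closed_UN) auto
  moreover have "x \<notin> ?C" using assms halfplane_Int halfplane_interface by fastforce
  ultimately have "open (- ?C)" "x \<in> - ?C" by (blast intro: open_Compl)+
  then obtain r where "r > 0" "ball x r \<subseteq> - ?C"
    using open_contains_ball by blast
  then have "\<S> \<inter> ball x r \<subseteq> \<P> i" unfolding ramified_space_eq by blast
  then show ?thesis using \<open>r > 0\<close> by blast
qed

section \<open>Test functions glued from C1 functions on the whole space\<close>

definition C1_fun :: "(real^3 \<Rightarrow> real) \<Rightarrow> (real^3 \<Rightarrow> real^3) \<Rightarrow> bool" where
  "C1_fun G g \<longleftrightarrow> (\<forall>x. (G has_derivative (\<lambda>h. g x \<bullet> h)) (at x)) \<and> continuous_on UNIV g"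

context
  fixes \<phi> :: "real^3 \<Rightarrow> real" and G g
  assumes eq: "\<And>j x. j \<in> J \<Longrightarrow> x \<in> \<P> j \<Longrightarrow> \<phi> x = G j x"
    and C1: "\<And>j. j \<in> J \<Longrightarrow> C1_fun (G j) (g j)"
begin

text \<open>On the half-plane \<open>\<phi>\<close> equals \<open>G j\<close> composed with
  \<open>proj j\<close>. The chain rule for the composition, with \<open>proj j\<close>
  self-adjoint, produces a vector that lies in the plane, as the definition of an inner gradient
  demands; \<open>g j x\<close> itself need not.\<close>

lemma is_inner_gradient_test:
  assumes "j \<in> J" "x \<in> \<P> j"
  shows "is_inner_gradient e j \<phi> x (proj j (g j x))"
proof -
  have px: "proj j x = x" using assms mem_halfplane by blast
  have "(G j has_derivative (\<lambda>h. g j x \<bullet> h)) (at (proj j x))"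
    using C1[OF assms(1)] px unfolding C1_fun_def by simp
  moreover have "(proj j has_derivative proj j) (at x within \<P> j)"
    using bounded_linear_proj by (rule bounded_linear_imp_has_derivative)
  ultimately have "((\<lambda>y. G j (proj j y)) has_derivative (\<lambda>h. g j x \<bullet> proj j h)) (at x within \<P> j)"
    by (rule has_derivative_compose[rotated])
  then have "((\<lambda>y. G j (proj j y)) has_derivative (\<lambda>h. proj j (g j x) \<bullet> h)) (at x within \<P> j)"
    using assms by (simp add: proj_inner)
  then have "(\<phi> has_derivative (\<lambda>h. proj j (g j x) \<bullet> h)) (at x within \<P> j)"
    using assms(2) by (rule has_derivative_transform[rotated 2])
      (use assms eq mem_halfplane in auto)
  then show ?thesis unfolding is_inner_gradient_def using assms by (simp add: mem_plane proj_proj)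
qed

lemma inner_gradient_test:
  assumes "j \<in> J" "x \<in> \<P> j - \<Gamma>"
  shows "inner_gradient e j \<phi> x = proj j (g j x)"
  unfolding inner_gradient_def
  using is_inner_gradient_test is_inner_gradient_unique[OF frame] assms[unfolded J_def] assms
  by (intro the_equality) blast+

lemma inner_gradient_tendsto:
  assumes "j \<in> J" "x \<in> \<P> j"
  shows "(inner_gradient e j \<phi> \<longlongrightarrow> proj j (g j x)) (at x within \<P> j - \<Gamma>)"
proof -
  have "continuous_on UNIV (\<lambda>x. proj j (g j x))"
    using C1[OF assms(1)] unfolding C1_fun_def by (intro continuous_intros) auto
  then have "((\<lambda>x. proj j (g j x)) \<longlongrightarrow> proj j (g j x)) (at x within \<P> j - \<Gamma>)"
    by (meson UNIV_I continuous_on_def subset_UNIV tendsto_within_subset)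
  moreover have "\<forall>\<^sub>F y in at x within \<P> j - \<Gamma>. proj j (g j y) = inner_gradient e j \<phi> y"
    using inner_gradient_test assms by (auto simp: eventually_at_filter)
  ultimately show ?thesis by (rule Lim_transform_eventually)
qed

lemma gradient_test:
  assumes "j \<in> J" "x \<in> \<P> j"
  shows "gradient e j \<phi> x = proj j (g j x)"
proof (cases "x \<in> \<Gamma>")
  case True
  \<comment> \<open>The gradient on the interface is a \<open>Lim\<close>, which is determined by
    convergence only along a nontrivial filter.\<close>
  have "x islimpt \<P> j - \<Gamma>"
    unfolding islimpt_approachable
  proof (intro allI impI)
    fix r :: real assume "r > 0"
    let ?y = "x + (r / 2) *\<^sub>R e j"
    have i: "?y \<bullet> e j = r / 2" using interface_inner[OF assms(1) True] assms by (simp add: inner_add_left)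
    have "proj j ?y = ?y"
      using assms by (simp add: proj_add proj_scaleR mem_halfplane) (simp add: proj_def)
    then have "?y \<in> \<P> j" using i assms \<open>r > 0\<close> by (simp add: mem_halfplane)
    moreover have "?y \<notin> \<Gamma>" using i \<open>r > 0\<close> interface_inner assms by fastforce
    moreover have "norm (e j) = 1" using assms by (auto simp: norm_eq_1)
    ultimately show "\<exists>y\<in>\<P> j - \<Gamma>. y \<noteq> x \<and> dist y x < r"
      using \<open>r > 0\<close> True by (intro bexI[of _ ?y]) (auto simp: dist_norm)
  qed
  then have "at x within \<P> j - \<Gamma> \<noteq> bot" by (simp add: trivial_limit_within)
  then show ?thesis unfolding gradient_def
    using tendsto_Lim[OF _ inner_gradient_tendsto[OF assms]] True by simp
qed (use inner_gradient_test assms in \<open>auto simp: gradient_def\<close>)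

lemma test_function: "\<phi> \<in> test_functions N e"
proof -
  have cont: "continuous_on (\<P> j) \<phi>" if "j \<in> J" for j
  proof -
    have "continuous_on (\<P> j) (G j)"
      using C1[OF that] unfolding C1_fun_def
      by (meson continuous_at_imp_continuous_on has_derivative_continuous)
    then show ?thesis using eq[OF that] by (simp cong: continuous_on_cong)
  qed
  moreover have "continuous_on \<S> \<phi>"
    unfolding ramified_space_eq using closed_halfplane cont
    by (intro continuous_on_closed_Union) auto
  moreover have "continuous_on (\<P> j) (gradient e j \<phi>)" if "j \<in> J" for j
  proof -
    have "continuous_on (\<P> j) (\<lambda>x. proj j (g j x))"
      using C1[OF that] continuous_on_subset unfolding C1_fun_def by (intro continuous_intros) blast
    then show ?thesis using gradient_test[OF that] by (simp cong: continuous_on_cong)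
  qed
  ultimately show ?thesis
    unfolding test_functions_def C1_halfplane_def J_def[symmetric]
    using is_inner_gradient_test inner_gradient_tendsto interface_halfplane by blast
qed

end

lemma C1_fun_continuous: "C1_fun G g \<Longrightarrow> continuous_on X G"
  unfolding C1_fun_def
  by (meson continuous_at_imp_continuous_on has_derivative_continuous)

lemma C1_fun_inner: "C1_fun (\<lambda>x. (x - b) \<bullet> w) (\<lambda>_. w)"
  unfolding C1_fun_def
  by (auto intro!: derivative_eq_intros continuous_intros simp: inner_commute)

lemma C1_fun_add:
  "C1_fun G g \<Longrightarrow> C1_fun H h \<Longrightarrow> C1_fun (\<lambda>x. G x + H x) (\<lambda>x. g x + h x)"
  unfolding C1_fun_def
  by (auto intro!: derivative_eq_intros continuous_intros simp: inner_add_left)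

lemma C1_fun_cmult: "C1_fun G g \<Longrightarrow> C1_fun (\<lambda>x. c * G x) (\<lambda>x. c *\<^sub>R g x)"
  unfolding C1_fun_def
  by (auto intro!: derivative_eq_intros continuous_intros)

lemma C1_fun_square: "C1_fun G g \<Longrightarrow> C1_fun (\<lambda>x. (G x)\<^sup>2) (\<lambda>x. (2 * G x) *\<^sub>R g x)"
  using C1_fun_continuous[of G g UNIV] unfolding C1_fun_def
  by (auto intro!: derivative_eq_intros continuous_intros)

lemma C1_fun_exp: "C1_fun G g \<Longrightarrow> C1_fun (\<lambda>x. exp (G x)) (\<lambda>x. exp (G x) *\<^sub>R g x)"
  using C1_fun_continuous[of G g UNIV] unfolding C1_fun_def
  by (auto intro!: derivative_eq_intros continuous_intros)

lemma C1_fun_norm_square: "C1_fun (\<lambda>x. (norm (x - b))\<^sup>2) (\<lambda>x. 2 *\<^sub>R (x - b))"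
  unfolding C1_fun_def power2_norm_eq_inner
  by (auto intro!: derivative_eq_intros continuous_intros simp: inner_commute)

text \<open>These rules match a function and its gradient simultaneously. The test functions below
  and their gradients are therefore written in exactly the shape that the rules produce, for
  instance with \<open>(- n) * t\<close> in place of a subtraction.\<close>

lemmas C1_fun_intros = C1_fun_inner C1_fun_add C1_fun_cmult C1_fun_square C1_fun_exp
  C1_fun_norm_square

end

section \<open>One-sided estimates for sub- and supersolutions\<close>

locale junction_comparison = junction N e for N e +
  fixes A :: "nat \<Rightarrow> 'a::metric_space set"
    and f :: "nat \<Rightarrow> real^3 \<Rightarrow> 'a \<Rightarrow> real^3"
    and l :: "nat \<Rightarrow> real^3 \<Rightarrow> 'a \<Rightarrow> real"
    and lam :: real and u v :: "real^3 \<Rightarrow> real"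
    and L M :: real and \<omega> :: "real \<Rightarrow> real"
  assumes lam_pos: "lam > 0"
    and H0: "H0 N e A f" and H1: "H1 N e A l" and H3: "H3 N e A f"
    and u_cont: "continuous_on \<S> u"
    and subsol: "viscosity_subsolution N e A f l lam u"
    and supersol: "viscosity_supersolution N e A f l lam v"
    and L_pos: "L > 0"
    and f_lip: "i \<in> J \<Longrightarrow> x \<in> \<P> i \<Longrightarrow> y \<in> \<P> i \<Longrightarrow> a \<in> A i \<Longrightarrow>
      norm (f i x a - f i y a) \<le> L * norm (x - y)"
    and M_pos: "M > 0"
    and f_bound: "i \<in> J \<Longrightarrow> x \<in> \<P> i \<Longrightarrow> a \<in> A i \<Longrightarrow> norm (f i x a) \<le> M"
    and l_bound: "i \<in> J \<Longrightarrow> x \<in> \<P> i \<Longrightarrow> a \<in> A i \<Longrightarrow> \<bar>l i x a\<bar> \<le> M"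
    and u_bound: "x \<in> \<S> \<Longrightarrow> \<bar>u x\<bar> \<le> M" and v_bound: "x \<in> \<S> \<Longrightarrow> \<bar>v x\<bar> \<le> M"
    and \<omega>_mod: "modulus_of_continuity \<omega>"
    and l_mod: "i \<in> J \<Longrightarrow> x \<in> \<P> i \<Longrightarrow> y \<in> \<P> i \<Longrightarrow> a \<in> A i \<Longrightarrow>
      \<bar>l i x a - l i y a\<bar> \<le> \<omega> (norm (x - y))"
begin

lemma f_plane: "i \<in> J \<Longrightarrow> x \<in> \<P> i \<Longrightarrow> a \<in> A i \<Longrightarrow> proj i (f i x a) = f i x a"
  using H0 mem_plane unfolding H0_def J_def by blast

lemma A_compact: "i \<in> J \<Longrightarrow> compact (A i)"
  using H0 unfolding H0_def J_def by blast

lemma f_cont: "i \<in> J \<Longrightarrow> x \<in> \<P> i \<Longrightarrow> continuous_on (A i) (\<lambda>a. f i x a)"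
  using H0 continuous_on_slice[of "\<P> i" "A i" "f i"] unfolding H0_def J_def by blast

lemma l_cont: "i \<in> J \<Longrightarrow> x \<in> \<P> i \<Longrightarrow> continuous_on (A i) (\<lambda>a. l i x a)"
  using H1 continuous_on_slice[of "\<P> i" "A i" "l i"] unfolding H1_def J_def by blast

lemma proj_inner_f:
  "i \<in> J \<Longrightarrow> x \<in> \<P> i \<Longrightarrow> a \<in> A i \<Longrightarrow> proj i p \<bullet> f i x a = p \<bullet> f i x a"
  by (simp add: proj_inner f_plane)

section \<open>Viscosity inequalities tested by C1 functions\<close>

lemma Ham_ge:
  assumes "i \<in> J" "x \<in> \<P> i" "a \<in> A i"
  shows "- (p \<bullet> f i x a) - l i x a \<le> Ham A f l i x p"
  unfolding Ham_def
proof (rule cSUP_upper[OF assms(3)])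
  have "compact ((\<lambda>a. - (p \<bullet> f i x a) - l i x a) ` A i)"
    by (intro compact_continuous_image continuous_intros f_cont l_cont A_compact assms)
  then show "bdd_above ((\<lambda>a. - (p \<bullet> f i x a) - l i x a) ` A i)"
    by (intro bounded_imp_bdd_above compact_imp_bounded)
qed

text \<open>A minimum of \<open>v - G\<close> is read as a maximum of \<open>G - v\<close>, so one
  notion serves both sides. It refers to a single half-plane, which allows contact on the interface
  to be checked half-plane by half-plane.\<close>

definition touching :: "nat \<Rightarrow> (real^3 \<Rightarrow> real) \<Rightarrow> real^3 \<Rightarrow> bool" where
  "touching i w x \<longleftrightarrow> (\<exists>r>0. \<forall>y\<in>\<P> i \<inter> ball x r. w y \<le> w x)"

lemma sub_test:
  assumes i: "i \<in> J" and x: "x \<in> \<P> i" "x \<bullet> e i > 0" and C1: "C1_fun G g"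
    and max: "touching i (\<lambda>y. u y - G y) x" and a: "a \<in> A i"
  shows "lam * u x - g x \<bullet> f i x a - l i x a \<le> 0"
proof -
  obtain r where r: "r > 0" "\<forall>y\<in>\<P> i \<inter> ball x r. u y - G y \<le> u x - G x"
    using max unfolding touching_def by blast
  obtain r' where r': "r' > 0" "\<S> \<inter> ball x r' \<subseteq> \<P> i"
    using interior_halfplane[OF i x] by blast
  have "local_max_on \<S> (\<lambda>y. u y - G y) x"
    unfolding local_max_on_def
  proof (intro conjI exI[of _ "min r r'"] ballI)
    show "x \<in> \<S>" using x(1) halfplane_subset[OF i] by blast
    show "u y - G y \<le> u x - G x" if "y \<in> \<S> \<inter> ball x (min r r')" for y
      using that r r' by auto
  qed (use r r' in auto)
  moreover have "G \<in> test_functions N e"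
    using test_function[of G "\<lambda>_. G" "\<lambda>_. g"] C1 by blast
  moreover have "x \<in> \<P> i - \<Gamma>" using halfplane_interface[OF i x(1)] x by auto
  ultimately have "lam * u x + Ham A f l i x (gradient e i G x) \<le> 0"
    using subsol i halfplane_subset[OF i] unfolding viscosity_subsolution_def J_def by blast
  moreover have "gradient e i G x = proj i (g x)"
    using gradient_test[of G "\<lambda>_. G" "\<lambda>_. g"] C1 i x(1) by blast
  ultimately show ?thesis
    using Ham_ge[OF i x(1) a, of "proj i (g x)"] proj_inner_f[OF i x(1) a, of "g x"] by simp
qed

text \<open>A lower bound for a maximum is informative only at a maximizing control, hence the
  existential; in \<open>sub_test\<close> an upper bound holds for every control. The control found
  here is later inserted there.\<close>

lemma super_test:
  assumes i: "i \<in> J" and x: "x \<in> \<P> i" "x \<bullet> e i > 0" and C1: "C1_fun G g"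
    and max: "touching i (\<lambda>y. G y - v y) x"
  shows "\<exists>a\<in>A i. lam * v x - g x \<bullet> f i x a - l i x a \<ge> 0"
proof -
  obtain r where r: "r > 0" "\<forall>y\<in>\<P> i \<inter> ball x r. G y - v y \<le> G x - v x"
    using max unfolding touching_def by blast
  obtain r' where r': "r' > 0" "\<S> \<inter> ball x r' \<subseteq> \<P> i"
    using interior_halfplane[OF i x] by blast
  have "local_min_on \<S> (\<lambda>y. v y - G y) x"
    unfolding local_min_on_def
  proof (intro conjI exI[of _ "min r r'"] ballI)
    show "x \<in> \<S>" using x(1) halfplane_subset[OF i] by blast
    show "v x - G x \<le> v y - G y" if "y \<in> \<S> \<inter> ball x (min r r')" for y
    proof -
      have "y \<in> \<P> i \<inter> ball x r" using that r' by auto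
      with r show ?thesis by force
    qed
  qed (use r r' in auto)
  moreover have "G \<in> test_functions N e"
    using test_function[of G "\<lambda>_. G" "\<lambda>_. g"] C1 by blast
  moreover have "x \<in> \<P> i - \<Gamma>" using halfplane_interface[OF i x(1)] x by auto
  ultimately have "lam * v x + Ham A f l i x (gradient e i G x) \<ge> 0"
    using supersol i halfplane_subset[OF i] unfolding viscosity_supersolution_def J_def by blast
  moreover have "gradient e i G x = proj i (g x)"
    using gradient_test[of G "\<lambda>_. G" "\<lambda>_. g"] C1 i x(1) by blast
  moreover obtain a where "a \<in> A i"
      "Ham A f l i x (proj i (g x)) = - (proj i (g x) \<bullet> f i x a) - l i x a"
    using Ham_attained[OF H0 H1 _ x(1)] i unfolding J_def by blast
  ultimately show ?thesis
    using proj_inner_f[OF i x(1), of a "g x"] by (intro bexI[of _ a]) auto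
qed

text \<open>Since \<open>Ham_interface\<close> is a maximum over finitely many half-planes of maxima
  over inward controls, it is attained at one index and one control. Each half-plane may use its own
  function, subject only to agreement on \<open>\<Gamma>\<close>.\<close>

lemma super_test_interface:
  assumes x: "x \<in> \<Gamma>" and C1: "\<And>i. i \<in> J \<Longrightarrow> C1_fun (G i) (g i)"
    and glue: "\<And>i k y. i \<in> J \<Longrightarrow> k \<in> J \<Longrightarrow> y \<in> \<Gamma> \<Longrightarrow> G i y = G k y"
    and max: "\<And>i. i \<in> J \<Longrightarrow> touching i (\<lambda>y. G i y - v y) x"
  shows "\<exists>i\<in>J. \<exists>a\<in>A i. f i x a \<bullet> e i \<ge> 0 \<and> lam * v x - g i x \<bullet> f i x a - l i x a \<ge> 0"
proof -
  \<comment> \<open>The choice of \<open>k\<close> is immaterial: two different half-planes meet in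
    \<open>\<Gamma>\<close>, where \<open>glue\<close> applies.\<close>
  define \<phi> where "\<phi> y = G (SOME k. k \<in> J \<and> y \<in> \<P> k) y" for y
  have eq: "\<phi> y = G i y" if "i \<in> J" "y \<in> \<P> i" for i y
  proof -
    define k where "k = (SOME k. k \<in> J \<and> y \<in> \<P> k)"
    have k: "k \<in> J" "y \<in> \<P> k" using someI[of "\<lambda>k. k \<in> J \<and> y \<in> \<P> k" i] that unfolding k_def by auto
    have "G k y = G i y"
      using halfplane_Int[OF k(1) that(1) _ k(2) that(2)] glue[OF k(1) that(1)] by (cases "k = i") auto
    then show ?thesis unfolding \<phi>_def k_def .
  qed
  from max have "\<forall>i\<in>J. \<exists>r>0. \<forall>y\<in>\<P> i \<inter> ball x r. G i y - v y \<le> G i x - v x"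
    unfolding touching_def by blast
  then obtain r where r: "\<And>i. i \<in> J \<Longrightarrow> r i > 0 \<and> (\<forall>y\<in>\<P> i \<inter> ball x (r i). G i y - v y \<le> G i x - v x)"
    by metis
  define R where "R = Min (r ` J)"
  have R: "R > 0" "\<And>i. i \<in> J \<Longrightarrow> R \<le> r i"
    unfolding R_def using r J_nonempty by auto
  have "local_min_on \<S> (\<lambda>y. v y - \<phi> y) x"
    unfolding local_min_on_def
  proof (intro conjI exI[of _ R] ballI)
    show "x \<in> \<S>" using interface_halfplane[OF x] J_nonempty unfolding ramified_space_eq by blast
    fix y assume y: "y \<in> \<S> \<inter> ball x R"
    then obtain i where i: "i \<in> J" "y \<in> \<P> i" unfolding ramified_space_eq by blast
    then have "y \<in> \<P> i \<inter> ball x (r i)" using y R(2)[OF i(1)] by auto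
    then have "G i y - v y \<le> G i x - v x" using r[OF i(1)] by blast
    then show "v x - \<phi> x \<le> v y - \<phi> y"
      using eq[OF i] eq[OF i(1) interface_halfplane[OF x]] by simp
  qed (use R in auto)
  moreover have "\<phi> \<in> test_functions N e" using test_function[of \<phi> G g] C1 eq by blast
  ultimately have *: "lam * v x + Ham_interface N e A f l x (\<lambda>i. gradient e i \<phi> x) \<ge> 0"
    using supersol x unfolding viscosity_supersolution_def local_min_on_def by blast
  have "Ham_interface N e A f l x (\<lambda>i. gradient e i \<phi> x)
      \<in> (\<lambda>i. Ham_plus e A f l i x (gradient e i \<phi> x)) ` J"
    unfolding Ham_interface_def J_def[symmetric] using J_nonempty by (intro Max_in) auto
  then obtain i where i: "i \<in> J"
      "Ham_interface N e A f l x (\<lambda>i. gradient e i \<phi> x) = Ham_plus e A f l i x (gradient e i \<phi> x)"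
    by auto
  have xi: "x \<in> \<P> i" using interface_halfplane[OF x] .
  have g: "gradient e i \<phi> x = proj i (g i x)"
    using gradient_test[of \<phi> G g] C1 i(1) xi eq by blast
  obtain a where a: "a \<in> A i" "f i x a \<bullet> e i \<ge> 0"
      "Ham_plus e A f l i x (proj i (g i x)) = - (proj i (g i x) \<bullet> f i x a) - l i x a"
    using Ham_plus_attained[OF H0 H1 H3 _ x] i(1) unfolding J_def by blast
  then show ?thesis
    using * i g proj_inner_f[OF i(1) xi, of a "g i x"] by (intro bexI[of _ i] bexI[of _ a]) auto
qed

text \<open>At the foot of \<open>z\<close> on the interface some control has velocity
  \<open>k\<close> opposite to the projected gradient \<open>?p\<close>, of length
  \<open>\<delta> / 2\<close>. Below the height \<open>\<delta> / (4 * L)\<close> its velocity at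
  \<open>z\<close> differs from \<open>k\<close> by at most \<open>\<delta> / 4\<close>, so
  \<open>- (?p \<bullet> f i z a) \<ge> norm ?p * \<delta> / 4\<close>, and the subsolution
  inequality bounds this by \<open>M + lam * M\<close>. Only the component in the plane is
  controlled, hence the condition on \<open>h\<close>.\<close>

lemma gradient_bound:
  obtains t0 K where "t0 > 0" "K > 0"
    "\<And>i z G g h. i \<in> J \<Longrightarrow> z \<in> \<P> i \<Longrightarrow> 0 < z \<bullet> e i \<Longrightarrow> z \<bullet> e i < t0 \<Longrightarrow> C1_fun G g \<Longrightarrow>
       touching i (\<lambda>y. u y - G y) z \<Longrightarrow> proj i h = h \<Longrightarrow> \<bar>g z \<bullet> h\<bar> \<le> K * norm h"
proof -
  obtain \<delta> where \<delta>: "\<delta> > 0"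
      "\<And>i x. i \<in> J \<Longrightarrow> x \<in> \<Gamma> \<Longrightarrow> ball 0 \<delta> \<inter> plane e i \<subseteq> {f i x a | a. a \<in> A i}"
    using H3 unfolding H3_def J_def by blast
  let ?t = "\<delta> / (4 * L)" and ?K = "4 * (M + lam * M) / \<delta>"
  show thesis
  proof (rule that)
    show "?t > 0" using \<delta> L_pos by simp
    show "?K > 0" using \<delta> M_pos lam_pos by (simp add: add_pos_pos)
    fix i z G g h
    assume i: "i \<in> J" and z: "z \<in> \<P> i" "0 < z \<bullet> e i" "z \<bullet> e i < ?t" and C1: "C1_fun G g"
      and max: "touching i (\<lambda>y. u y - G y) z" and h: "proj i h = h"
    let ?p = "proj i (g z)" and ?y = "(z \<bullet> e 0) *\<^sub>R e 0"
    have "norm ?p \<le> ?K"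
    proof (cases "?p = 0")
      case False
      define k where "k = - (\<delta> / (2 * norm ?p)) *\<^sub>R ?p"
      have nk: "norm k = \<delta> / 2" using False \<delta> unfolding k_def by simp
      have pk: "?p \<bullet> k = - (\<delta> / 2 * norm ?p)"
        using False unfolding k_def by (simp add: dot_square_norm power2_eq_square)
      have "k \<in> ball 0 \<delta> \<inter> plane e i"
        using nk \<delta> i unfolding k_def by (simp add: mem_plane proj_scaleR proj_proj flip: scaleR_minus_left)
      moreover have y: "?y \<in> \<Gamma>" by (simp add: mem_interface)
      ultimately obtain a where a: "a \<in> A i" "f i ?y a = k" using \<delta>(2)[OF i y] by blast
      have zy: "z - ?y = (z \<bullet> e i) *\<^sub>R e i"
        using z(1) i unfolding mem_halfplane[OF i] proj_def by (simp add: algebra_simps)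
      have ne: "norm (e i) = 1" using i by (simp add: norm_eq_1)
      have "norm (z - ?y) = z \<bullet> e i" unfolding zy using z ne by simp
      then have "norm (f i z a - k) \<le> L * (z \<bullet> e i)"
        using f_lip[OF i z(1) interface_halfplane[OF y] a(1)] a(2) by simp
      also have "\<dots> \<le> \<delta> / 4" using z(3) L_pos by (simp add: field_simps)
      finally have "norm ?p * norm (f i z a - k) \<le> norm ?p * (\<delta> / 4)" by (rule mult_left_mono) simp
      with Cauchy_Schwarz_ineq2[of ?p "f i z a - k"]
      have "\<bar>?p \<bullet> (f i z a - k)\<bar> \<le> norm ?p * (\<delta> / 4)" by linarith
      moreover have "lam * u z - ?p \<bullet> f i z a - l i z a \<le> 0"
        using sub_test[OF i z(1,2) C1 max a(1)] proj_inner_f[OF i z(1) a(1)] by simp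
      moreover have "\<bar>l i z a\<bar> \<le> M" using l_bound[OF i z(1) a(1)] .
      moreover have "\<bar>lam * u z\<bar> \<le> lam * M"
        using u_bound halfplane_subset[OF i] z(1) lam_pos by (auto simp: abs_mult)
      moreover have "?p \<bullet> f i z a = ?p \<bullet> (f i z a - k) + ?p \<bullet> k" by (simp add: inner_diff_right)
      moreover have "norm ?p * (\<delta> / 4) * 2 = \<delta> / 2 * norm ?p" by simp
      ultimately have "norm ?p * (\<delta> / 4) \<le> M + lam * M" using pk by linarith
      then show ?thesis using \<delta> by (simp add: field_simps)
    qed (use \<delta> M_pos lam_pos in simp)
    moreover have "g z \<bullet> h = ?p \<bullet> h" using i h by (simp add: proj_inner)
    ultimately show "\<bar>g z \<bullet> h\<bar> \<le> ?K * norm h"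
      using Cauchy_Schwarz_ineq2[of ?p h] mult_right_mono[of "norm ?p" ?K "norm h"] by simp
  qed
qed

text \<open>The exponential below makes the test function strictly steeper than \<open>c\<close> along \<open>d\<close> and so
  high at the near end of the tube that the maximum cannot be there.\<close>

lemma directional_bound:
  assumes i: "i \<in> J" and d: "proj i d = d" and \<eta>: "\<eta> > 0"
    and x: "x \<in> \<P> i" "x \<in> ball z \<rho>" "x \<bullet> e i > 0"
    and x': "x + \<eta> *\<^sub>R d \<in> ball z \<rho>" "(x + \<eta> *\<^sub>R d) \<bullet> e i > 0"
    and test: "\<And>y G g. y \<in> \<P> i \<Longrightarrow> y \<in> ball z \<rho> \<Longrightarrow> y \<bullet> e i > 0 \<Longrightarrow> C1_fun G g \<Longrightarrow>
      touching i (\<lambda>y. u y - G y) y \<Longrightarrow> - (g y \<bullet> d) \<le> c"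
  shows "u x - u (x + \<eta> *\<^sub>R d) \<le> c * \<eta>"
proof (rule ccontr)
  define x1 where "x1 = x + \<eta> *\<^sub>R d"
  define gap where "gap = u x - u x1 - c * \<eta>"
  assume "\<not> ?thesis"
  then have gap: "gap > 0" unfolding gap_def x1_def by simp
  \<comment> \<open>\<open>s\<close> is the coordinate along \<open>d\<close>, with \<open>x\<close>
    at 0 and \<open>x1\<close> at \<open>\<eta>\<close>, and \<open>w\<close> is the part orthogonal
    to \<open>d\<close>. For \<open>d = 0\<close> division by zero gives \<open>s = 0\<close>, and
    the argument still works with a ball as tube.\<close>
  define s where "s y = (y - x) \<bullet> (d /\<^sub>R (norm d)\<^sup>2)" for y
  define w where "w y = y - x - s y *\<^sub>R d" for y
  define W where "W y = (norm (y - x))\<^sup>2 + (- (norm d)\<^sup>2) * (s y)\<^sup>2" for y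
  have sd: "(y - x) \<bullet> d = s y * (norm d)\<^sup>2" for y unfolding s_def by (cases "d = 0") auto
  have W: "W y = (norm (w y))\<^sup>2" for y
  proof -
    have "(norm (p - t *\<^sub>R d))\<^sup>2 = (norm p)\<^sup>2 - 2 * t * (p \<bullet> d) + t\<^sup>2 * (norm d)\<^sup>2" for p t
      unfolding power2_norm_eq_inner
      by (simp add: inner_diff_left inner_diff_right inner_commute
        power2_eq_square algebra_simps)
    from this[of "y - x" "s y"] show ?thesis
      unfolding W_def w_def sd by (simp add: power2_eq_square algebra_simps)
  qed
  define O' where "O' = {y. y \<bullet> e i > 0} \<inter> ball z \<rho>"
  have "{y. y \<bullet> e i > 0} = {y. e i \<bullet> y > 0}" by (simp add: inner_commute)
  then have O': "open O'" "convex O'"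
    unfolding O'_def by (auto intro!: open_Int convex_Int simp: open_halfspace_gt convex_halfspace_gt)
  have x1: "x1 \<in> \<P> i"
    using i x x' d unfolding x1_def by (simp add: mem_halfplane proj_add proj_scaleR)
  obtain r1 where r1: "r1 > 0" "ball x r1 \<subseteq> O'"
    using O'(1) x open_contains_ball unfolding O'_def by blast
  obtain r2 where r2: "r2 > 0" "ball x1 r2 \<subseteq> O'"
    using O'(1) x' open_contains_ball unfolding O'_def x1_def by blast
  have ucont: "continuous_on (\<P> i) u" using u_cont halfplane_subset[OF i] by (rule continuous_on_subset)
  obtain r3 where r3: "r3 > 0" "\<And>y. y \<in> \<P> i \<Longrightarrow> dist y x1 < r3 \<Longrightarrow> dist (u y) (u x1) < gap / 4"
    using ucont[unfolded continuous_on_iff, rule_format, OF x1, of "gap / 4"] gap by auto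
  \<comment> \<open>The half-width of the tube: together with \<open>a\<close>, the length added
    behind \<open>x\<close>, it keeps the near end in \<open>ball x r1\<close>; the bounds by
    \<open>r2\<close> and \<open>r3\<close> keep the far end in \<open>O'\<close> and
    \<open>u\<close> there within \<open>gap / 4\<close> of \<open>u x1\<close>.\<close>
  define \<rho>' where "\<rho>' = min (r1 / 2) (min r2 r3 / 2)"
  have \<rho>': "\<rho>' > 0" "\<rho>' \<le> r1 / 2" "\<rho>' < r2" "\<rho>' < r3" unfolding \<rho>'_def using r1 r2 r3 by auto
  define a where "a = r1 / (2 * (norm d + 1))"
  have a: "a > 0" "a * norm d < r1 / 2"
  proof -
    have "norm d + 1 > 0" using norm_ge_zero[of d] by linarith
    then show "a > 0" "a * norm d < r1 / 2" using r1 unfolding a_def by (simp_all add: divide_simps)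
  qed
  define T where "T = {y \<in> \<P> i. - a \<le> s y \<and> s y \<le> \<eta> \<and> W y \<le> \<rho>'\<^sup>2}"
  have wT: "norm (w y) \<le> \<rho>'" if "y \<in> T" for y
    using that \<rho>'(1) unfolding T_def W by (auto simp: power2_le_iff_abs_le)
  \<comment> \<open>Each point of the tube lies on a segment parallel to \<open>d\<close> whose ends
    are in the balls around \<open>x\<close> and \<open>x1\<close>, so convexity of
    \<open>O'\<close> suffices.\<close>
  have TO: "y \<in> O'" if y: "y \<in> T" for y
  proof -
    define \<theta> where "\<theta> = (s y + a) / (\<eta> + a)"
    have \<theta>: "0 \<le> \<theta>" "\<theta> \<le> 1" using y a \<eta> unfolding \<theta>_def T_def by auto
    have "x - a *\<^sub>R d + w y \<in> O'"
    proof -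
      have "norm (a *\<^sub>R d - w y) \<le> a * norm d + norm (w y)"
        using norm_triangle_ineq4[of "a *\<^sub>R d" "w y"] a by simp
      then have "dist x (x - a *\<^sub>R d + w y) < r1"
        using a wT[OF y] \<rho>' by (simp add: dist_norm)
      then show ?thesis using r1(2) by auto
    qed
    moreover have "x1 + w y \<in> O'" using r2(2) wT[OF y] \<rho>'(3) by (auto simp: dist_norm)
    ultimately have "(1 - \<theta>) *\<^sub>R (x - a *\<^sub>R d + w y) + \<theta> *\<^sub>R (x1 + w y) \<in> O'"
      using O'(2) \<theta> by (simp add: convex_alt)
    also have "(1 - \<theta>) *\<^sub>R (x - a *\<^sub>R d + w y) + \<theta> *\<^sub>R (x1 + w y) = x + (\<theta> * (\<eta> + a) - a) *\<^sub>R d + w y"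
      unfolding x1_def by (simp add: algebra_simps)
    also have "\<theta> * (\<eta> + a) - a = s y" using a \<eta> unfolding \<theta>_def by simp
    also have "x + s y *\<^sub>R d + w y = y" unfolding w_def by simp
    finally show ?thesis .
  qed
  have cont_s: "continuous_on X s" for X unfolding s_def by (intro continuous_intros)
  have cont_W: "continuous_on X W" for X unfolding W_def by (intro continuous_intros cont_s)
  have "closed T"
  proof -
    have "T = \<P> i \<inter> ({y. - a \<le> s y} \<inter> ({y. s y \<le> \<eta>} \<inter> {y. W y \<le> \<rho>'\<^sup>2}))" unfolding T_def by auto
    then show ?thesis
      using closed_halfplane[OF i]
      by (auto intro!: closed_Int closed_Collect_le continuous_intros cont_s cont_W)
  qed
  moreover have "bounded T"
  proof (rule bounded_subset[OF bounded_ball])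
    show "T \<subseteq> ball z \<rho>" using TO unfolding O'_def by blast
  qed
  ultimately have "compact T" by (simp add: compact_eq_bounded_closed)
  \<comment> \<open>The value to beat is \<open>u x - \<kappa>\<close>, attained at
    \<open>x\<close>. The three constants exclude the three parts of the boundary:
    \<open>\<kappa>\<close> the far end, where \<open>u y - G y\<close> is at most
    \<open>u x - 3 * gap / 4\<close>; \<open>k'\<close> the near end, through
    \<open>exp t \<ge> 1 + t\<close>; \<open>k\<close> the lateral side, through
    \<open>k * \<rho>'\<^sup>2\<close>.\<close>
  define \<kappa> where "\<kappa> = gap / 2"
  define k' where "k' = (2 * M + \<bar>c\<bar> * a + 1) / (\<kappa> * a)"
  define k where "k = (2 * M + \<bar>c\<bar> * (a + \<eta>) + \<kappa> + 1) / \<rho>'\<^sup>2"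
  have \<kappa>: "\<kappa> > 0" unfolding \<kappa>_def using gap by simp
  have k': "k' > 0" unfolding k'_def using M_pos a \<kappa> by (intro divide_pos_pos add_nonneg_pos) auto
  have k: "k \<ge> 0" unfolding k_def using M_pos a \<kappa> \<eta> by simp
  define G where "G y = (- c) * s y + (\<kappa> * exp ((- k') * s y) + k * W y)" for y
  have "continuous_on T u" using ucont by (rule continuous_on_subset) (auto simp: T_def)
  then have "continuous_on T (\<lambda>y. u y - G y)"
    unfolding G_def by (intro continuous_intros cont_s cont_W)
  moreover have sx: "s x = 0" "W x = 0" unfolding W_def s_def by auto
  then have xT: "x \<in> T" unfolding T_def using a \<eta> x by simp
  ultimately obtain y where y: "y \<in> T" "\<And>y'. y' \<in> T \<Longrightarrow> u y' - G y' \<le> u y - G y"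
    using continuous_attains_sup[OF \<open>compact T\<close>, of "\<lambda>y. u y - G y"] by blast
  have Gx: "u x - \<kappa> \<le> u y - G y" using y(2)[OF xT] sx by (simp add: G_def)
  have yP: "y \<in> \<P> i" "- a \<le> s y" "s y \<le> \<eta>" "W y \<le> \<rho>'\<^sup>2" using y(1) unfolding T_def by auto
  have uM: "u x \<ge> - M" "u y \<le> M"
    using u_bound[of x] u_bound[of y] halfplane_subset[OF i] x(1) yP(1) by auto
  have W0: "k * W y \<ge> 0" using k unfolding W by simp
  have exp0: "\<kappa> * exp ((- k') * s y) \<ge> 0" using \<kappa> by simp
  have "s y \<noteq> - a"
  proof
    assume sy: "s y = - a"
    have "\<kappa> * (1 + k' * a) \<le> \<kappa> * exp (k' * a)"
      using \<kappa> exp_ge_add_one_self[of "k' * a"] by (intro mult_left_mono) auto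
    moreover have "\<kappa> * (1 + k' * a) = \<kappa> + (2 * M + \<bar>c\<bar> * a + 1)"
      using \<kappa> a unfolding k'_def by (simp add: field_simps)
    moreover have "- (c * a) \<le> \<bar>c\<bar> * a" using a abs_ge_minus_self[of "c * a"] by (simp add: abs_mult)
    ultimately show False using Gx W0 uM sy unfolding G_def by simp
  qed
  moreover have "W y \<noteq> \<rho>'\<^sup>2"
  proof
    assume Wy: "W y = \<rho>'\<^sup>2"
    then have "k * W y = 2 * M + \<bar>c\<bar> * (a + \<eta>) + \<kappa> + 1" unfolding k_def using \<rho>' by simp
    moreover have "c * s y \<le> \<bar>c\<bar> * (a + \<eta>)"
    proof -
      have "c * s y \<le> \<bar>c\<bar> * \<bar>s y\<bar>" using abs_ge_self[of "c * s y"] by (simp add: abs_mult)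
      also have "\<dots> \<le> \<bar>c\<bar> * (a + \<eta>)" using yP a \<eta> by (intro mult_left_mono) auto
      finally show ?thesis .
    qed
    ultimately show False using Gx exp0 uM unfolding G_def by simp
  qed
  moreover have "s y \<noteq> \<eta>"
  proof
    assume sy: "s y = \<eta>"
    have "y - x1 = w y" unfolding w_def x1_def sy by simp
    then have "dist y x1 < r3" using wT[OF y(1)] \<rho>' by (simp add: dist_norm)
    then have "u y < u x1 + gap / 4" using r3(2)[OF yP(1) \<open>dist y x1 < r3\<close>, unfolded dist_real_def] by linarith
    then show False using Gx W0 exp0 sy gap unfolding G_def \<kappa>_def gap_def by (simp add: field_simps)
  qed
  ultimately have int: "- a < s y" "s y < \<eta>" "W y < \<rho>'\<^sup>2" using yP by auto
  define U where "U = {y. - a < s y} \<inter> ({y. s y < \<eta>} \<inter> {y. W y < \<rho>'\<^sup>2})"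
  have "open U" unfolding U_def by (intro open_Int open_Collect_less continuous_intros cont_s cont_W)
  then obtain r where r: "r > 0" "ball y r \<subseteq> U" using int open_contains_ball unfolding U_def by blast
  have "touching i (\<lambda>y. u y - G y) y"
    unfolding touching_def
  proof (intro exI[of _ r] conjI ballI)
    fix y' assume "y' \<in> \<P> i \<inter> ball y r"
    then have "y' \<in> T" using r(2) unfolding U_def T_def by force
    then show "u y' - G y' \<le> u y - G y" by (rule y(2))
  qed (rule r)
  moreover define d' where "d' = d /\<^sub>R (norm d)\<^sup>2"
  define g where "g y = (- c) *\<^sub>R d' + (\<kappa> *\<^sub>R (exp ((- k') * s y) *\<^sub>R ((- k') *\<^sub>R d')) +
    k *\<^sub>R (2 *\<^sub>R (y - x) + (- (norm d)\<^sup>2) *\<^sub>R ((2 * s y) *\<^sub>R d')))" for y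
  have "C1_fun G g"
    unfolding G_def g_def W_def s_def d'_def by (intro C1_fun_intros)
  ultimately have "- (g y \<bullet> d) \<le> c"
    using test[OF yP(1), of G g] TO[OF y(1)] unfolding O'_def by auto
  \<comment> \<open>\<open>W\<close> has no derivative along \<open>d\<close>, so only the linear
    and the exponential term contribute. If \<open>d = 0\<close>, a positive gap means
    \<open>c < 0\<close>.\<close>
  moreover have "c < - (g y \<bullet> d)"
  proof (cases "d = 0")
    case True
    then show ?thesis using gap \<eta> unfolding gap_def x1_def by (simp add: mult_less_0_iff)
  next
    case False
    have "d' \<bullet> d = 1" unfolding d'_def using False by (simp add: dot_square_norm)
    then have "g y \<bullet> d = - c - \<kappa> * exp ((- k') * s y) * k'"
      unfolding g_def inner_add_left inner_scaleR_left sd by (simp add: algebra_simps)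
    moreover have "\<kappa> * exp ((- k') * s y) * k' > 0" using \<kappa> k' by simp
    ultimately show ?thesis by linarith
  qed
  ultimately show False by simp
qed

section \<open>One-sided slopes at the interface\<close>

lemma u_cont_halfplane: "i \<in> J \<Longrightarrow> continuous_on (\<P> i) u"
  using u_cont halfplane_subset by (rule continuous_on_subset)

text \<open>The direction is frozen at \<open>y\<close>, because the supersolution condition will be
  tested there with the velocities \<open>f i y a\<close>. At a contact point \<open>z\<close> the
  true velocity is \<open>f i z a\<close>; exchanging the two costs at most
  \<open>K * (L * norm (z - y))\<close> by the gradient bound. The other two terms of
  \<open>E\<close> account for the variation of \<open>l\<close> and of \<open>u\<close>.\<close>

lemma interface_rate:
  assumes i: "i \<in> J" and x: "x \<in> \<Gamma>" and y: "y \<in> \<Gamma>" and a: "a \<in> A i"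
    and inward: "f i y a \<bullet> e i \<ge> 0"
    and K: "K > 0" "\<And>z G g h. z \<in> \<P> i \<Longrightarrow> 0 < z \<bullet> e i \<Longrightarrow> z \<bullet> e i < \<rho> \<Longrightarrow> C1_fun G g \<Longrightarrow>
       touching i (\<lambda>y. u y - G y) z \<Longrightarrow> proj i h = h \<Longrightarrow> \<bar>g z \<bullet> h\<bar> \<le> K * norm h"
    and \<rho>: "\<rho> > 0"
    and err: "\<And>z. z \<in> \<P> i \<Longrightarrow> z \<in> ball x \<rho> \<Longrightarrow>
      \<omega> (norm (z - y)) + K * (L * norm (z - y)) + lam * \<bar>u z - u x\<bar> \<le> E"
  shows "\<exists>\<eta>0>0. \<forall>\<eta>\<in>{0..\<eta>0}.
    u x - u (x + \<eta> *\<^sub>R f i y a) \<le> (l i y a - lam * u x + E) * \<eta>"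
proof (intro exI[of _ "\<rho> / (2 * (M + 1))"] conjI ballI)
  show "\<rho> / (2 * (M + 1)) > 0" using \<rho> M_pos by simp
  fix \<eta> assume \<eta>: "\<eta> \<in> {0..\<rho> / (2 * (M + 1))}"
  let ?d = "f i y a" and ?c = "l i y a - lam * u x + E"
  have ne: "norm (e i) = 1" using i by (simp add: norm_eq_1)
  have yP: "y \<in> \<P> i" and xP: "x \<in> \<P> i" using x y by (auto intro: interface_halfplane)
  have d: "proj i ?d = ?d" "norm ?d \<le> M" using f_plane[OF i yP a] f_bound[OF i yP a] by auto
  have xi: "x \<bullet> e i = 0" using interface_inner[OF i x] .
  have pe: "proj i (e i) = e i" using i by (simp add: proj_def)
  have px: "proj i x = x" using xP i by (simp add: mem_halfplane)
  have \<eta>d: "norm (\<eta> *\<^sub>R ?d) < \<rho> / 2"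
  proof -
    have "norm (\<eta> *\<^sub>R ?d) \<le> \<eta> * M" using \<eta> d(2) by (simp add: mult_left_mono)
    also have "\<dots> \<le> \<rho> / (2 * (M + 1)) * M" using \<eta> M_pos by (intro mult_right_mono) auto
    also have "\<dots> < \<rho> / 2" using \<rho> M_pos by (simp add: field_simps)
    finally show ?thesis .
  qed
  show "u x - u (x + \<eta> *\<^sub>R ?d) \<le> ?c * \<eta>"
  proof (cases "\<eta> = 0")
    case False
    then have \<eta>0: "\<eta> > 0" using \<eta> by simp
    \<comment> \<open>The segment may run inside \<open>\<Gamma>\<close>, where
      \<open>sub_test\<close> gives nothing. It is lifted by \<open>\<mu>\<close> along
      \<open>e i\<close>, and continuity of \<open>u\<close> lets \<open>\<mu>\<close> tend to 0; a
      lift and a displacement below \<open>\<rho> / 2\<close> each keep it in the ball.\<close>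
    let ?F = "\<lambda>\<mu>. u (x + \<mu> *\<^sub>R e i) - u (x + \<mu> *\<^sub>R e i + \<eta> *\<^sub>R ?d)"
    have inP: "x + \<mu> *\<^sub>R e i + s *\<^sub>R ?d \<in> \<P> i" if "\<mu> \<ge> 0" "s \<ge> 0" for \<mu> s
      using that i px pe d inward
      by (simp add: mem_halfplane proj_add proj_scaleR inner_add_left xi)
    have inP0: "x + \<mu> *\<^sub>R e i \<in> \<P> i" if "\<mu> \<ge> 0" for \<mu> using inP[OF that, of 0] by simp
    have bnd: "?F \<mu> \<le> ?c * \<eta>" if \<mu>: "0 < \<mu>" "\<mu> < \<rho> / 2" for \<mu>
    proof (rule directional_bound[OF i d(1) \<eta>0, of _ x \<rho>])
      show "x + \<mu> *\<^sub>R e i \<in> \<P> i" using inP0 \<mu> by simp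
      show "x + \<mu> *\<^sub>R e i \<in> ball x \<rho>" using \<mu> ne by (simp add: dist_norm)
      show "(x + \<mu> *\<^sub>R e i) \<bullet> e i > 0" using \<mu> i xi by (simp add: inner_add_left)
      have "norm (\<mu> *\<^sub>R e i + \<eta> *\<^sub>R ?d) < \<rho>"
        using norm_triangle_ineq[of "\<mu> *\<^sub>R e i" "\<eta> *\<^sub>R ?d"] \<eta>d \<mu> ne by simp
      moreover have "dist x (x + \<mu> *\<^sub>R e i + \<eta> *\<^sub>R ?d) = norm (\<mu> *\<^sub>R e i + \<eta> *\<^sub>R ?d)"
        using norm_minus_cancel[of "\<mu> *\<^sub>R e i + \<eta> *\<^sub>R ?d"] by (simp add: dist_norm algebra_simps)
      ultimately show "x + \<mu> *\<^sub>R e i + \<eta> *\<^sub>R ?d \<in> ball x \<rho>" by simp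
      show "(x + \<mu> *\<^sub>R e i + \<eta> *\<^sub>R ?d) \<bullet> e i > 0"
        using \<mu> \<eta>0 i xi inward by (simp add: inner_add_left add_pos_nonneg)
    next
      fix z G g
      assume z: "z \<in> \<P> i" "z \<in> ball x \<rho>" "z \<bullet> e i > 0" and C1: "C1_fun G g"
        and max: "touching i (\<lambda>y. u y - G y) z"
      have "z \<bullet> e i = (z - x) \<bullet> e i" by (simp add: inner_diff_left xi)
      also have "\<dots> \<le> norm (z - x)" using norm_cauchy_schwarz[of "z - x" "e i"] ne by simp
      also have "\<dots> < \<rho>" using z(2) by (simp add: dist_norm norm_minus_commute)
      finally have zt: "z \<bullet> e i < \<rho>" .
      have "\<bar>g z \<bullet> (f i z a - ?d)\<bar> \<le> K * norm (f i z a - ?d)"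
        using K(2)[OF z(1,3) zt C1 max] d f_plane[OF i z(1) a] by (simp add: proj_diff)
      also have "\<dots> \<le> K * (L * norm (z - y))"
        using f_lip[OF i z(1) yP a] K(1) by (intro mult_left_mono) auto
      finally have "\<bar>g z \<bullet> f i z a - g z \<bullet> ?d\<bar> \<le> K * (L * norm (z - y))"
        by (simp add: inner_diff_right)
      moreover have "lam * u z - g z \<bullet> f i z a - l i z a \<le> 0" by (rule sub_test[OF i z(1,3) C1 max a])
      moreover have "\<bar>l i z a - l i y a\<bar> \<le> \<omega> (norm (z - y))" by (rule l_mod[OF i z(1) yP a])
      moreover have "lam * u x \<le> lam * u z + lam * \<bar>u z - u x\<bar>"
        using mult_left_mono[of "u x" "u z + \<bar>u z - u x\<bar>" lam] lam_pos by (simp add: algebra_simps)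
      ultimately show "- (g z \<bullet> ?d) \<le> ?c" using err[OF z(1,2)] by linarith
    qed
    have "continuous_on {0..} ?F"
      by (intro continuous_intros continuous_on_compose2[OF u_cont_halfplane[OF i]])
        (use inP inP0 \<eta>0 in auto)
    then have "(?F \<longlongrightarrow> ?F 0) (at 0 within {0..})"
      using bspec[of "{0..}" "\<lambda>m. (?F \<longlongrightarrow> ?F m) (at m within {0..})" 0]
      unfolding continuous_on_def by simp
    then have "(?F \<longlongrightarrow> ?F 0) (at_right 0)" by (rule tendsto_within_subset) auto
    moreover have "eventually (\<lambda>\<mu>. ?F \<mu> \<le> ?c * \<eta>) (at_right 0)"
      using bnd \<rho> unfolding eventually_at_right_field by (intro exI[of _ "\<rho> / 2"]) auto
    ultimately have "?F 0 \<le> ?c * \<eta>" by (intro tendsto_upperbound) auto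
    then show ?thesis by simp
  qed simp
qed

text \<open>Moving \<open>x\<close> along an inward velocity while \<open>y\<close> moves at equal
  height turns the rate for \<open>u - \<zeta>\<close> into growth of \<open>v\<close>: reaching
  height \<open>t\<close> takes time \<open>t / f1 a\<close> and gains about \<open>F a\<close> per
  unit of time. So every control supports the normal slope \<open>F a / f1 a\<close>. The best
  control alone yields the contact, and its optimality yields the inequality for all the others.
  Subtracting \<open>\<kappa>\<close> pays for the quadratic remainder and keeps the quotient away
  from tangential controls.\<close>

lemma interface_slope:
  assumes i: "i \<in> J" and x: "x \<in> \<Gamma>" and y: "y \<in> \<Gamma>" and n: "n > 0" and \<kappa>: "\<kappa> > 0" and r0: "r0 > 0"
    and rate: "\<And>a. a \<in> A i \<Longrightarrow> f i y a \<bullet> e i \<ge> 0 \<Longrightarrow>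
      \<exists>\<eta>0>0. \<forall>\<eta>\<in>{0..\<eta>0}. (u x - \<zeta> x) - (u (x + \<eta> *\<^sub>R f i y a) - \<zeta> (x + \<eta> *\<^sub>R f i y a))
        \<le> (l i y a - lam * u x + E) * \<eta>"
    and max: "\<And>x' y'. x' \<in> \<P> i \<inter> ball x r0 \<Longrightarrow> y' \<in> \<P> i \<inter> ball y r0 \<Longrightarrow> y' - x' \<in> \<Gamma> \<Longrightarrow>
      u x' - v y' - \<zeta> x' - n * (norm (x' - y'))\<^sup>2 \<le> u x - v y - \<zeta> x - n * (norm (x - y))\<^sup>2"
    and p0: "p0 = 2 * n * ((x - y) \<bullet> e 0)"
  shows "\<exists>r. touching i (\<lambda>y'. p0 * ((y' - y) \<bullet> e 0) + ((- 2 * n) * ((y' - y) \<bullet> e 0)\<^sup>2 +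
        r * ((y' - y) \<bullet> e i)) - v y') y \<and>
      (\<forall>a\<in>A i. f i y a \<bullet> e i \<ge> 0 \<longrightarrow>
        lam * u x - l i y a - E - \<kappa> - p0 * (f i y a \<bullet> e 0) \<le> r * (f i y a \<bullet> e i))"
proof -
  define f0 where "f0 a = f i y a \<bullet> e 0" for a
  define f1 where "f1 a = f i y a \<bullet> e i" for a
  define F where "F a = lam * u x - l i y a - E - p0 * f0 a" for a
  have ne: "norm (e i) = 1" using i by (simp add: norm_eq_1)
  have yP: "y \<in> \<P> i" and xP: "x \<in> \<P> i" using x y by (auto intro: interface_halfplane)
  have xi: "x \<bullet> e i = 0" "y \<bullet> e i = 0" using interface_inner[OF i] x y by auto
  have xy0: "x = (x \<bullet> e 0) *\<^sub>R e 0" "y = (y \<bullet> e 0) *\<^sub>R e 0" using x y mem_interface by auto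
  let ?D = "(x - y) \<bullet> e 0"
  \<comment> \<open>The height of \<open>y'\<close> fixes \<open>\<eta>\<close>, while its
    tangential coordinate stays free. As \<open>x'\<close> has the same height, the pair is
    admissible in \<open>max\<close>.\<close>
  have key: "\<exists>\<eta>1>0. \<forall>\<eta>\<in>{0..\<eta>1}. \<forall>y'\<in>\<P> i \<inter> ball y r0. y' \<bullet> e i = \<eta> * f1 a \<longrightarrow>
      v y + p0 * ((y' - y) \<bullet> e 0) - 2 * n * ((y' - y) \<bullet> e 0)\<^sup>2 + \<eta> * F a - 2 * n * (\<eta>\<^sup>2 * (f0 a)\<^sup>2) \<le> v y'"
    if a: "a \<in> A i" "f1 a \<ge> 0" for a
  proof -
    obtain \<eta>0 where \<eta>0: "\<eta>0 > 0" "\<And>\<eta>. \<eta> \<in> {0..\<eta>0} \<Longrightarrow>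
        (u x - \<zeta> x) - (u (x + \<eta> *\<^sub>R f i y a) - \<zeta> (x + \<eta> *\<^sub>R f i y a)) \<le> (l i y a - lam * u x + E) * \<eta>"
      using rate[OF a(1)] a(2) unfolding f1_def by blast
    have fp: "proj i (f i y a) = f i y a" "norm (f i y a) \<le> M"
      using f_plane[OF i yP a(1)] f_bound[OF i yP a(1)] by auto
    show ?thesis
    proof (intro exI[of _ "min \<eta>0 (r0 / (M + 1))"] conjI ballI impI)
      show "0 < min \<eta>0 (r0 / (M + 1))" using \<eta>0 r0 M_pos by simp
      fix \<eta> y' assume \<eta>: "\<eta> \<in> {0..min \<eta>0 (r0 / (M + 1))}" and y': "y' \<in> \<P> i \<inter> ball y r0"
        and y'i: "y' \<bullet> e i = \<eta> * f1 a"
      define x' where "x' = x + \<eta> *\<^sub>R f i y a"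
      let ?dt = "(y' - y) \<bullet> e 0"
      have "norm (\<eta> *\<^sub>R f i y a) \<le> r0 / (M + 1) * M"
        using \<eta> fp M_pos r0 by (simp add: mult_mono del: times_divide_eq_left)
      also have "\<dots> < r0" using r0 M_pos by (simp add: field_simps)
      finally have "x' \<in> ball x r0" unfolding x'_def by (simp add: dist_norm)
      moreover have "x' \<in> \<P> i"
        using \<eta> a i xP xi fp unfolding x'_def f1_def
        by (simp add: mem_halfplane proj_add proj_scaleR inner_add_left)
      moreover have eq: "x' - y' = (?D + \<eta> * f0 a - ?dt) *\<^sub>R e 0"
      proof -
        have "y' = (y' \<bullet> e 0) *\<^sub>R e 0 + (\<eta> * f1 a) *\<^sub>R e i"
          using y' i y'i by (simp add: mem_halfplane proj_def)
        moreover have "f i y a = f0 a *\<^sub>R e 0 + f1 a *\<^sub>R e i"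
          using fp unfolding f0_def f1_def by (simp add: proj_def)
        then have "x' = (x \<bullet> e 0 + \<eta> * f0 a) *\<^sub>R e 0 + (\<eta> * f1 a) *\<^sub>R e i"
          unfolding x'_def using xy0(1) by (simp add: algebra_simps)
        ultimately have "x' - y' = (x \<bullet> e 0 + \<eta> * f0 a - y' \<bullet> e 0) *\<^sub>R e 0"
          by (metis (no_types, lifting) add_diff_cancel_right scaleR_diff_left)
        then show ?thesis by (simp add: inner_diff_left)
      qed
      have "y' - x' = - (x' - y')" by simp
      then have "y' - x' = (- (?D + \<eta> * f0 a - ?dt)) *\<^sub>R e 0" unfolding eq scaleR_minus_left .
      then have "y' - x' \<in> \<Gamma>" unfolding interface_def span_singleton by blast
      ultimately have "u x' - v y' - \<zeta> x' - n * (norm (x' - y'))\<^sup>2 \<le> u x - v y - \<zeta> x - n * (norm (x - y))\<^sup>2"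
        using max y' by blast
      moreover have "(norm (e 0)) = 1" by (simp add: norm_eq_1)
      then have "(norm (x' - y'))\<^sup>2 = (?D + (\<eta> * f0 a - ?dt))\<^sup>2"
        unfolding eq norm_scaleR by (simp add: add_diff_eq)
      moreover have "x - y = ?D *\<^sub>R e 0"
        using xy0 by (metis inner_diff_left scaleR_diff_left)
      then have "(norm (x - y))\<^sup>2 = ?D\<^sup>2" using \<open>norm (e 0) = 1\<close> by (metis norm_scaleR mult.right_neutral power2_abs)
      moreover have "(u x - \<zeta> x) - (u x' - \<zeta> x') \<le> (l i y a - lam * u x + E) * \<eta>"
        using \<eta>0(2)[of \<eta>] \<eta> unfolding x'_def by simp
      moreover have "n * (?D + (\<eta> * f0 a - ?dt))\<^sup>2 - n * ?D\<^sup>2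
          \<le> \<eta> * (p0 * f0 a) - p0 * ?dt + 2 * n * (\<eta>\<^sup>2 * (f0 a)\<^sup>2) + 2 * n * ?dt\<^sup>2"
      proof -
        \<comment> \<open>Half of the parallelogram inequality: the square of a difference is at
          most twice the sum of the squares. The linear part is the derivative \<open>p0\<close> of
          the penalty.\<close>
        have "0 \<le> n * (\<eta> * f0 a + ?dt)\<^sup>2" using n by simp
        then show ?thesis unfolding p0 by (simp add: power2_eq_square algebra_simps)
      qed
      ultimately show "v y + p0 * ?dt - 2 * n * ?dt\<^sup>2 + \<eta> * F a - 2 * n * (\<eta>\<^sup>2 * (f0 a)\<^sup>2) \<le> v y'"
        unfolding F_def by (simp add: algebra_simps)
    qed
  qed
  \<comment> \<open>Here \<open>y' = y\<close> is admissible for every small \<open>\<eta>\<close>,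
    so \<open>\<eta> * F a\<close> is bounded by a term quadratic in \<open>\<eta>\<close>.\<close>
  have tangential: "F a \<le> 0" if a: "a \<in> A i" "f1 a = 0" for a
  proof (rule ccontr)
    assume "\<not> F a \<le> 0"
    obtain \<eta>1 where \<eta>1: "\<eta>1 > 0" "\<And>\<eta>. \<eta> \<in> {0..\<eta>1} \<Longrightarrow> \<eta> * F a - 2 * n * (\<eta>\<^sup>2 * (f0 a)\<^sup>2) \<le> 0"
      using key[OF a(1)] a(2) yP r0 xi by fastforce
    define \<eta> where "\<eta> = min \<eta>1 (F a / (4 * n * (f0 a)\<^sup>2 + 1))"
    have pos: "4 * n * (f0 a)\<^sup>2 + 1 > 0" using n by (simp add: add_nonneg_pos)
    have \<eta>: "\<eta> > 0" unfolding \<eta>_def using \<eta>1 \<open>\<not> F a \<le> 0\<close> pos by simp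
    have "\<eta> * (4 * n * (f0 a)\<^sup>2 + 1) \<le> F a"
      using pos unfolding \<eta>_def by (simp add: min_le_iff_disj flip: pos_le_divide_eq)
    then have "2 * n * (f0 a)\<^sup>2 * \<eta> < F a"
      using n \<eta> \<open>\<not> F a \<le> 0\<close> by (simp add: algebra_simps)
    then have "\<eta> * (2 * n * (f0 a)\<^sup>2 * \<eta>) < \<eta> * F a" using \<eta> by (rule mult_strict_left_mono)
    moreover have "\<eta> * F a - 2 * n * (\<eta>\<^sup>2 * (f0 a)\<^sup>2) \<le> 0" using \<eta>1(2)[of \<eta>] \<eta> unfolding \<eta>_def by simp
    ultimately show False by (simp add: power2_eq_square algebra_simps)
  qed
  have cont: "continuous_on (A i) F" "continuous_on (A i) f1"
    unfolding F_def f0_def f1_def by (intro continuous_intros f_cont l_cont i yP)+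
  obtain a0 where a0: "a0 \<in> A i" "f1 a0 > 0"
  proof -
    obtain \<delta> where "\<delta> > 0" "ball 0 \<delta> \<inter> plane e i \<subseteq> {f i y a | a. a \<in> A i}"
      using H3 i y unfolding H3_def J_def by blast
    moreover have "(\<delta> / 2) *\<^sub>R e i \<in> ball 0 \<delta> \<inter> plane e i"
      using \<open>\<delta> > 0\<close> i ne by (simp add: mem_plane proj_scaleR) (simp add: proj_def)
    ultimately obtain a where "a \<in> A i" "f i y a = (\<delta> / 2) *\<^sub>R e i" by force
    then show thesis using that[of a] \<open>\<delta> > 0\<close> i unfolding f1_def by simp
  qed
  \<comment> \<open>Maximize \<open>(F - \<kappa>) / f1\<close> over \<open>f1 > 0\<close>: on the superlevel set \<open>C\<close> of the value at \<open>a0\<close> no \<open>a\<close>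
    has \<open>f1 a = 0\<close>, since there \<open>F \<le> 0\<close>, so \<open>C\<close> is compact and the quotient is continuous on it.\<close>
  define s0 where "s0 = (F a0 - \<kappa>) / f1 a0"
  define C where "C = {a \<in> A i. 0 \<le> f1 a \<and> 0 \<le> F a - \<kappa> - s0 * f1 a}"
  have "C = A i \<inter> ((A i \<inter> f1 -` {0..}) \<inter> (A i \<inter> (\<lambda>a. F a - \<kappa> - s0 * f1 a) -` {0..}))"
    unfolding C_def by auto
  also have "compact \<dots>"
    using A_compact[OF i] cont
    by (intro compact_Int_closed closed_Int continuous_closed_preimage continuous_intros)
      (auto intro: compact_imp_closed)
  finally have "compact C" .
  have "a0 \<in> C" using a0 unfolding C_def s0_def by simp
  have C1: "f1 a > 0" if "a \<in> C" for a
    using that tangential[of a] \<kappa> unfolding C_def by (cases "f1 a = 0") auto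
  have "continuous_on C (\<lambda>a. (F a - \<kappa>) / f1 a)"
    using C1 cont continuous_on_subset[of "A i" _ C] unfolding C_def
    by (intro continuous_intros) force+
  then obtain as where as: "as \<in> C" "\<And>a. a \<in> C \<Longrightarrow> (F a - \<kappa>) / f1 a \<le> (F as - \<kappa>) / f1 as"
    using continuous_attains_sup[OF \<open>compact C\<close>, of "\<lambda>a. (F a - \<kappa>) / f1 a"] \<open>a0 \<in> C\<close> by blast
  define r where "r = (F as - \<kappa>) / f1 as"
  have as': "as \<in> A i" "f1 as > 0" "r * f1 as = F as - \<kappa>"
    using as(1) C1[OF as(1)] unfolding r_def C_def by auto
  have s0r: "s0 \<le> r" using as(2)[OF \<open>a0 \<in> C\<close>] unfolding s0_def r_def .
  have "F a - \<kappa> \<le> r * f1 a" if a: "a \<in> A i" "f1 a \<ge> 0" for a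
  proof (cases "a \<in> C")
    case True
    then show ?thesis using as(2)[OF True] C1[OF True] unfolding r_def[symmetric] by (simp add: field_simps)
  next
    case False
    then have "F a - \<kappa> < s0 * f1 a" using a unfolding C_def by auto
    also have "\<dots> \<le> r * f1 a" using s0r a by (intro mult_right_mono)
    finally show ?thesis by simp
  qed
  then have "\<forall>a\<in>A i. f i y a \<bullet> e i \<ge> 0 \<longrightarrow>
        lam * u x - l i y a - E - \<kappa> - p0 * (f i y a \<bullet> e 0) \<le> r * (f i y a \<bullet> e i)"
    unfolding F_def f0_def f1_def by (simp add: algebra_simps)
  moreover have "touching i (\<lambda>y'. p0 * ((y' - y) \<bullet> e 0) + ((- 2 * n) * ((y' - y) \<bullet> e 0)\<^sup>2 +
        r * ((y' - y) \<bullet> e i)) - v y') y"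
  proof -
    obtain \<eta>1 where \<eta>1: "\<eta>1 > 0" "\<And>\<eta> y'. \<eta> \<in> {0..\<eta>1} \<Longrightarrow> y' \<in> \<P> i \<inter> ball y r0 \<Longrightarrow>
        y' \<bullet> e i = \<eta> * f1 as \<Longrightarrow>
      v y + p0 * ((y' - y) \<bullet> e 0) - 2 * n * ((y' - y) \<bullet> e 0)\<^sup>2 + \<eta> * F as - 2 * n * (\<eta>\<^sup>2 * (f0 as)\<^sup>2) \<le> v y'"
      using key[OF as'(1)] as'(2) by (meson less_imp_le)
    have pos: "2 * n * (f0 as)\<^sup>2 + 1 > 0" using n by (simp add: add_nonneg_pos)
    \<comment> \<open>Within this radius \<open>\<eta> \<le> \<eta>1\<close>, and the quadratic
      remainder is at most \<open>\<eta> * \<kappa>\<close>.\<close>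
    define r1 where "r1 = min r0 (f1 as * min \<eta>1 (\<kappa> / (2 * n * (f0 as)\<^sup>2 + 1)))"
    show ?thesis unfolding touching_def
    proof (intro exI[of _ r1] conjI ballI)
      show "r1 > 0" unfolding r1_def using r0 \<eta>1 as' \<kappa> pos by simp
      fix y' assume y': "y' \<in> \<P> i \<inter> ball y r1"
      define \<eta> where "\<eta> = (y' \<bullet> e i) / f1 as"
      have eq: "y' \<bullet> e i = \<eta> * f1 as" unfolding \<eta>_def using as' by simp
      have "\<eta> \<ge> 0" unfolding \<eta>_def using y' as' i by (simp add: mem_halfplane)
      have "y' \<bullet> e i = (y' - y) \<bullet> e i" by (simp add: inner_diff_left xi)
      also have "\<dots> \<le> norm (y' - y)" using norm_cauchy_schwarz[of "y' - y" "e i"] ne by simp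
      also have "\<dots> < r1" using y' by (simp add: dist_norm norm_minus_commute)
      also have "r1 \<le> f1 as * min \<eta>1 (\<kappa> / (2 * n * (f0 as)\<^sup>2 + 1))" unfolding r1_def by simp
      finally have "\<eta> < min \<eta>1 (\<kappa> / (2 * n * (f0 as)\<^sup>2 + 1))"
        unfolding eq using as'(2) by (simp add: mult.commute)
      then have \<eta>: "\<eta> \<in> {0..\<eta>1}" "\<eta> * (2 * n * (f0 as)\<^sup>2 + 1) < \<kappa>"
        using \<open>\<eta> \<ge> 0\<close> pos by (auto simp: pos_less_divide_eq)
      have "2 * n * (f0 as)\<^sup>2 * \<eta> \<le> \<kappa>" using \<eta>(2) \<open>\<eta> \<ge> 0\<close> by (simp add: algebra_simps)
      then have "\<eta> * (2 * n * (f0 as)\<^sup>2 * \<eta>) \<le> \<eta> * \<kappa>" using \<open>\<eta> \<ge> 0\<close> by (rule mult_left_mono)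
      then have "2 * n * (\<eta>\<^sup>2 * (f0 as)\<^sup>2) \<le> \<eta> * \<kappa>" by (simp add: power2_eq_square algebra_simps)
      moreover have "r * (y' \<bullet> e i) = \<eta> * F as - \<eta> * \<kappa>"
      proof -
        have "r * (y' \<bullet> e i) = \<eta> * (r * f1 as)" unfolding eq by simp
        then show ?thesis unfolding as'(3) by (simp add: right_diff_distrib)
      qed
      moreover have "y' \<in> \<P> i \<inter> ball y r0" using y' unfolding r1_def by auto
      ultimately have "v y + p0 * ((y' - y) \<bullet> e 0) - 2 * n * ((y' - y) \<bullet> e 0)\<^sup>2 + r * (y' \<bullet> e i) \<le> v y'"
        using \<eta>1(2)[OF \<eta>(1) _ eq] by linarith
      then show "p0 * ((y' - y) \<bullet> e 0) + ((- 2 * n) * ((y' - y) \<bullet> e 0)\<^sup>2 + r * ((y' - y) \<bullet> e i)) - v y' \<le>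
        p0 * ((y - y) \<bullet> e 0) + ((- 2 * n) * ((y - y) \<bullet> e 0)\<^sup>2 + r * ((y - y) \<bullet> e i)) - v y"
        by (simp add: inner_diff_left[of _ _ "e i"] xi)
    qed
  qed
  ultimately show ?thesis by blast
qed

section \<open>Doubling of variables\<close>

lemma doubling_usc:
  assumes K: "K \<subseteq> \<S> \<times> \<S>" and Z: "continuous_on K Z" and z: "z \<in> K"
    and c: "u (fst z) - v (snd z) - Z z < c"
  shows "eventually (\<lambda>w. u (fst w) - v (snd w) - Z w < c) (at z within K)"
proof -
  define \<eta> where "\<eta> = (c - (u (fst z) - v (snd z) - Z z)) / 2"
  have \<eta>: "\<eta> > 0" "c = u (fst z) - v (snd z) - Z z + 2 * \<eta>"
    using c unfolding \<eta>_def by (simp_all add: field_simps)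
  have "continuous_on K (\<lambda>w. u (fst w) - Z w)"
    using K by (intro continuous_intros Z continuous_on_compose2[OF u_cont]) auto
  then have "((\<lambda>w. u (fst w) - Z w) \<longlongrightarrow> u (fst z) - Z z) (at z within K)"
    using z unfolding continuous_on_def by blast
  then have "eventually (\<lambda>w. u (fst w) - Z w < u (fst z) - Z z + \<eta>) (at z within K)"
    using \<eta> by (intro order_tendstoD) auto
  moreover have "eventually (\<lambda>w. v (snd z) - \<eta> < v (snd w)) (at z within K)"
  proof -
    have "snd z \<in> \<S>" using z K by auto
    then have "eventually (\<lambda>y. v (snd z) - \<eta> < v y) (at (snd z) within \<S>)"
      using supersol \<eta>(1) unfolding viscosity_supersolution_def lsc_on_def by simp
    then obtain U where U: "open U" "snd z \<in> U"
        "\<And>y. y \<in> U \<Longrightarrow> y \<noteq> snd z \<Longrightarrow> y \<in> \<S> \<Longrightarrow> v (snd z) - \<eta> < v y"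
      unfolding eventually_at_topological by blast
    \<comment> \<open>\<open>w\<close> may differ from \<open>z\<close> in the first component only,
      a case which the punctured neighbourhood of \<open>snd z\<close> leaves out.\<close>
    have "v (snd z) - \<eta> < v (snd w)" if "w \<in> UNIV \<times> U" "w \<in> K" for w
      using U(3)[of "snd w"] that K \<eta>(1) by (cases "snd w = snd z") auto
    then show ?thesis
      unfolding eventually_at_topological
      using U(1,2) by (intro exI[of _ "UNIV \<times> U"]) (auto intro: open_Times simp: mem_Times_iff)
  qed
  ultimately show ?thesis
  proof eventually_elim
    case (elim w)
    then show ?case using \<eta>(2) by linarith
  qed
qed

text \<open>The control comes from the supersolution inequality at \<open>y\<close> and is inserted
  into the subsolution inequality at \<open>x\<close>. The gradient terms are left as they are,
  since each doubling makes them small for a different reason.\<close>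

lemma doubling_estimate:
  assumes i: "i \<in> J" and x: "x \<in> \<P> i" "x \<bullet> e i > 0" and y: "y \<in> \<P> i" "y \<bullet> e i > 0"
    and C1: "C1_fun G g" "C1_fun H h"
    and max: "touching i (\<lambda>x. u x - G x) x" "touching i (\<lambda>y. H y - v y) y"
  shows "\<exists>a\<in>A i. lam * (u x - v y) \<le> g x \<bullet> f i x a - h y \<bullet> f i y a + \<omega> (norm (x - y))"
proof -
  obtain a where a: "a \<in> A i" "lam * v y - h y \<bullet> f i y a - l i y a \<ge> 0"
    using super_test[OF i y C1(2) max(2)] by blast
  have "lam * u x - g x \<bullet> f i x a - l i x a \<le> 0" by (rule sub_test[OF i x C1(1) max(1) a(1)])
  moreover have "\<bar>l i x a - l i y a\<bar> \<le> \<omega> (norm (x - y))" by (rule l_mod[OF i x(1) y(1) a(1)])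
  ultimately show ?thesis using a by (intro bexI[of _ a]) (auto simp: right_diff_distrib)
qed

lemma \<omega>_small:
  assumes "c > 0" obtains r where "r > 0" "\<And>t. 0 \<le> t \<Longrightarrow> t < r \<Longrightarrow> \<omega> t \<le> c"
proof -
  have "(\<omega> \<longlongrightarrow> 0) (at_right 0)" "\<omega> 0 = 0" using \<omega>_mod unfolding modulus_of_continuity_def by auto
  then have "eventually (\<lambda>t. \<omega> t < c) (at_right 0)" using assms by (intro order_tendstoD) auto
  then obtain r where r: "r > 0" "\<And>t. 0 < t \<Longrightarrow> t < r \<Longrightarrow> \<omega> t < c"
    unfolding eventually_at_right_field by auto
  have "\<omega> t \<le> c" if "0 \<le> t" "t < r" for t
    using r(2)[of t] that assms \<open>\<omega> 0 = 0\<close> by (cases "t = 0") auto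
  with r(1) show thesis using that by blast
qed

text \<open>The first term confines maxima of \<open>u - v\<close> to a compact set, the second
  makes the maximum point \<open>xs\<close> strict. Only the first variable is penalized, so only
  slopes of \<open>u\<close> carry the gradient. The form \<open>x - 0\<close> fits
  \<open>C1_fun_norm_square\<close>.\<close>

definition \<zeta> :: "real \<Rightarrow> real^3 \<Rightarrow> real^3 \<Rightarrow> real" where
  "\<zeta> \<beta> xs x = \<beta> * (norm (x - 0))\<^sup>2 + (norm (x - xs))\<^sup>2"

definition \<zeta>' :: "real \<Rightarrow> real^3 \<Rightarrow> real^3 \<Rightarrow> real^3" where
  "\<zeta>' \<beta> xs x = \<beta> *\<^sub>R (2 *\<^sub>R (x - 0)) + 2 *\<^sub>R (x - xs)"

lemma C1_fun_\<zeta>: "C1_fun (\<zeta> \<beta> xs) (\<zeta>' \<beta> xs)"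
  unfolding \<zeta>_def \<zeta>'_def by (intro C1_fun_intros)

lemma continuous_on_\<zeta> [continuous_intros]:
  "continuous_on X g \<Longrightarrow> continuous_on X (\<lambda>x. \<zeta> \<beta> xs (g x))"
  unfolding \<zeta>_def by (intro continuous_intros)

lemma \<zeta>_expand: "\<zeta> \<beta> xs (x + \<eta> *\<^sub>R d) = \<zeta> \<beta> xs x + \<eta> * (\<zeta>' \<beta> xs x \<bullet> d) + (\<beta> + 1) * \<eta>\<^sup>2 * (norm d)\<^sup>2"
  unfolding \<zeta>_def \<zeta>'_def power2_norm_eq_inner
  by (simp add: inner_add_left inner_add_right inner_diff_left inner_diff_right
    inner_commute[of d x] inner_commute[of xs x] inner_commute[of d xs] power2_eq_square algebra_simps)

section \<open>Contradiction at a maximum point of the penalized difference\<close>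

context
  fixes \<beta> \<mu> Q \<rho>0 :: real and xs :: "real^3"
  assumes \<beta>: "\<beta> > 0" and \<mu>: "\<mu> > 0" and Q: "Q = lam * \<mu>" and xs: "xs \<in> \<S>"
    and xs_max: "\<And>x. x \<in> \<S> \<Longrightarrow> u x - v x - \<beta> * (norm x)\<^sup>2 \<le> u xs - v xs - \<beta> * (norm xs)\<^sup>2"
    and xs_val: "u xs - v xs - \<beta> * (norm xs)\<^sup>2 \<ge> \<mu>"
    and \<rho>0: "\<rho>0 > 0" "\<And>x. dist x xs < \<rho>0 \<Longrightarrow> M * norm (\<zeta>' \<beta> xs x) \<le> Q / 4"
begin

lemma Q_pos: "Q > 0" using Q \<mu> lam_pos by simp

lemma diagonal_le:
  "x \<in> \<S> \<Longrightarrow> u x - v x - \<zeta> \<beta> xs x \<le> u xs - v xs - \<zeta> \<beta> xs xs - (norm (x - xs))\<^sup>2"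
  using xs_max[of x] unfolding \<zeta>_def by simp

text \<open>A doubled maximum dominates the diagonal value at \<open>xs\<close>, and dropping
  nonnegative penalties only increases the right-hand side.\<close>

lemma gap_ge:
  assumes "u xs - v xs - \<zeta> \<beta> xs xs \<le> u x - v y - \<zeta> \<beta> xs x - d" "d \<ge> 0"
  shows "Q \<le> lam * (u x - v y)"
proof -
  have "\<zeta> \<beta> xs x \<ge> 0" unfolding \<zeta>_def using \<beta> by simp
  then have "\<mu> \<le> u x - v y" using assms xs_val unfolding \<zeta>_def by simp
  then show ?thesis unfolding Q using lam_pos by simp
qed

text \<open>Within half the height of \<open>xs\<close> only one Hamiltonian is met. The conclusion
  also serves later: the height of a point is then at most its distance to \<open>xs\<close>, which
  places nearby points in the strip where gradients are bounded.\<close>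

lemma maximum_in_interface: "xs \<in> \<Gamma>"
proof (rule ccontr)
  assume "xs \<notin> \<Gamma>"
  obtain i where i: "i \<in> J" "xs \<in> \<P> i" using xs unfolding ramified_space_eq by blast
  have ne: "norm (e i) = 1" using i by (simp add: norm_eq_1)
  have xsi: "xs \<bullet> e i > 0" using halfplane_interface[OF i] \<open>xs \<notin> \<Gamma>\<close> i by (auto simp: mem_halfplane)
  define \<rho> where "\<rho> = xs \<bullet> e i / 2"
  have \<rho>: "\<rho> > 0" unfolding \<rho>_def using xsi by simp
  define B where "B = \<P> i \<inter> cball xs \<rho>"
  have B: "x \<in> \<P> i" "x \<bullet> e i > 0" if "x \<in> B" for x
  proof -
    show "x \<in> \<P> i" using that unfolding B_def by blast
    have "(xs - x) \<bullet> e i \<le> norm (xs - x)" using norm_cauchy_schwarz[of "xs - x" "e i"] ne by simp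
    also have "\<dots> \<le> \<rho>" using that unfolding B_def by (simp add: dist_norm)
    finally show "x \<bullet> e i > 0" using xsi unfolding \<rho>_def by (simp add: inner_diff_left)
  qed
  have BS: "B \<subseteq> \<S>" unfolding B_def using halfplane_subset[OF i(1)] by blast
  define g where "g z = u (fst z) - v (snd z) - \<zeta> \<beta> xs (fst z)" for z
  define d where "d z = (norm (fst z - snd z))\<^sup>2" for z :: "(real^3) \<times> (real^3)"
  obtain r where r: "r > 0" "\<And>t. 0 \<le> t \<Longrightarrow> t < r \<Longrightarrow> \<omega> t \<le> Q / 4"
    using \<omega>_small[of "Q / 4"] Q_pos by auto
  \<comment> \<open>In order: contact inside \<open>B\<close>, gradient of \<open>\<zeta>\<close>,
    modulus \<open>\<omega>\<close>, and \<open>2 * L * (n * d) \<le> Q / 4\<close> for the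
    Lipschitz term.\<close>
  define \<epsilon> where "\<epsilon> = min (min \<rho> \<rho>0) (min (r / 2) (Q / (8 * L)))"
  have \<epsilon>: "\<epsilon> > 0" unfolding \<epsilon>_def using \<rho> \<rho>0 r Q_pos L_pos by simp
  have \<epsilon>': "\<epsilon> \<le> \<rho>" "\<epsilon> \<le> \<rho>0" "\<epsilon> \<le> r / 2" "\<epsilon> \<le> Q / (8 * L)" unfolding \<epsilon>_def by auto
  have "\<exists>n>0. \<exists>z\<in>B \<times> B. (\<forall>w\<in>B \<times> B. g w - n * d w \<le> g z - n * d z) \<and> dist z (xs, xs) < \<epsilon> \<and> n * d z < \<epsilon>"
  proof (rule penalized_maximum)
    have "compact B" unfolding B_def using closed_halfplane[OF i(1)] compact_cball closed_Int_compact by blast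
    then show "compact (B \<times> B)" by (intro compact_Times)
    show "(xs, xs) \<in> B \<times> B" unfolding B_def using i \<rho> by simp
    show "d (xs, xs) = 0" unfolding d_def by simp
    show "continuous_on (B \<times> B) d" unfolding d_def by (intro continuous_intros)
    show "d z \<ge> 0" for z unfolding d_def by simp
    show "eventually (\<lambda>w. g w < c) (at z within B \<times> B)" if "z \<in> B \<times> B" "g z < c" for z c
      using that BS unfolding g_def by (intro doubling_usc continuous_intros) auto
    show "g z < g (xs, xs)" if z: "z \<in> B \<times> B" "d z = 0" "z \<noteq> (xs, xs)" for z
    proof -
      have eq: "fst z = snd z" using z unfolding d_def by simp
      then have "(norm (fst z - xs))\<^sup>2 > 0" using z(3) by (cases z) auto
      moreover have "fst z \<in> \<S>" using z(1) BS by auto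
      then have "g z \<le> g (xs, xs) - (norm (fst z - xs))\<^sup>2"
        using diagonal_le[of "fst z"] eq unfolding g_def by simp
      ultimately show ?thesis by linarith
    qed
  qed (rule \<epsilon>)
  then obtain n x y where n: "n > 0" and xy: "x \<in> B" "y \<in> B" "dist (x, y) (xs, xs) < \<epsilon>" "n * d (x, y) < \<epsilon>"
    and max: "\<And>x' y'. x' \<in> B \<Longrightarrow> y' \<in> B \<Longrightarrow> g (x', y') - n * d (x', y') \<le> g (x, y) - n * d (x, y)"
    by auto
  have dx: "dist x xs < \<epsilon>" "dist y xs < \<epsilon>"
    using xy(3) dist_fst_le[of "(x, y)" "(xs, xs)"] dist_snd_le[of "(x, y)" "(xs, xs)"] by auto
  define G where "G x' = \<zeta> \<beta> xs x' + n * (norm (x' - y))\<^sup>2" for x'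
  define H where "H y' = (- n) * (norm (y' - x))\<^sup>2" for y'
  define G' where "G' x' = \<zeta>' \<beta> xs x' + n *\<^sub>R (2 *\<^sub>R (x' - y))" for x'
  define H' where "H' y' = (- n) *\<^sub>R (2 *\<^sub>R (y' - x))" for y'
  have near: "\<P> i \<inter> ball x (\<rho> - dist x xs) \<subseteq> B" if "dist x xs < \<epsilon>" for x
  proof
    fix x' assume x': "x' \<in> \<P> i \<inter> ball x (\<rho> - dist x xs)"
    then show "x' \<in> B" unfolding B_def using dist_triangle[of xs x' x] by (simp add: dist_commute)
  qed
  have "touching i (\<lambda>x'. u x' - G x') x"
    unfolding touching_def
  proof (intro exI[of _ "\<rho> - dist x xs"] conjI ballI)
    show "u x' - G x' \<le> u x - G x" if "x' \<in> \<P> i \<inter> ball x (\<rho> - dist x xs)" for x'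
      using max[OF subsetD[OF near[OF dx(1)] that] xy(2)] unfolding g_def d_def G_def by simp
  qed (use dx \<epsilon>' in simp)
  moreover have "touching i (\<lambda>y'. H y' - v y') y"
    unfolding touching_def
  proof (intro exI[of _ "\<rho> - dist y xs"] conjI ballI)
    show "H y' - v y' \<le> H y - v y" if "y' \<in> \<P> i \<inter> ball y (\<rho> - dist y xs)" for y'
      using max[OF xy(1) subsetD[OF near[OF dx(2)] that]] unfolding g_def d_def H_def
      by (simp add: norm_minus_commute)
  qed (use dx \<epsilon>' in simp)
  moreover have "C1_fun G G'" "C1_fun H H'"
    unfolding G_def G'_def H_def H'_def by (intro C1_fun_intros C1_fun_\<zeta>)+
  ultimately obtain a where a: "a \<in> A i"
      "lam * (u x - v y) \<le> G' x \<bullet> f i x a - H' y \<bullet> f i y a + \<omega> (norm (x - y))"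
    using doubling_estimate[OF i(1) B[OF xy(1)] B[OF xy(2)]] by blast
  have expand: "G' x \<bullet> f i x a - H' y \<bullet> f i y a
      = \<zeta>' \<beta> xs x \<bullet> f i x a + 2 * n * ((x - y) \<bullet> (f i x a - f i y a))"
    unfolding G'_def H'_def by (simp add: inner_add_left inner_diff_left inner_diff_right algebra_simps)
  have drift: "\<zeta>' \<beta> xs x \<bullet> f i x a \<le> Q / 4"
  proof -
    have "\<zeta>' \<beta> xs x \<bullet> f i x a \<le> norm (\<zeta>' \<beta> xs x) * norm (f i x a)" by (rule norm_cauchy_schwarz)
    also have "\<dots> \<le> norm (\<zeta>' \<beta> xs x) * M"
      using f_bound[OF i(1) B(1)[OF xy(1)] a(1)] by (intro mult_left_mono) auto
    also have "\<dots> \<le> Q / 4" using \<rho>0(2)[of x] dx \<epsilon>' by (simp add: mult.commute)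
    finally show ?thesis .
  qed
  have lip: "2 * n * ((x - y) \<bullet> (f i x a - f i y a)) \<le> Q / 4"
  proof -
    have "(x - y) \<bullet> (f i x a - f i y a) \<le> norm (x - y) * (L * norm (x - y))"
      using norm_cauchy_schwarz f_lip[OF i(1) B(1)[OF xy(1)] B(1)[OF xy(2)] a(1)]
      by (meson mult_left_mono norm_ge_zero order_trans)
    then have "2 * n * ((x - y) \<bullet> (f i x a - f i y a)) \<le> 2 * n * (norm (x - y) * (L * norm (x - y)))"
      using n by (intro mult_left_mono) auto
    also have "\<dots> = 2 * L * (n * d (x, y))" unfolding d_def by (simp add: power2_eq_square)
    also have "\<dots> \<le> 2 * L * (Q / (8 * L))" using xy(4) \<epsilon>'(4) L_pos by (intro mult_left_mono) auto
    also have "\<dots> = Q / 4" using L_pos by simp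
    finally show ?thesis .
  qed
  have "\<omega> (norm (x - y)) \<le> Q / 4"
  proof (rule r(2))
    show "norm (x - y) < r" using dist_triangle[of x y xs] dx \<epsilon>' by (simp add: dist_norm norm_minus_commute)
  qed simp
  then have "lam * (u x - v y) \<le> 3 * Q / 4" using a(2) expand drift lip by linarith
  moreover have "Q \<le> lam * (u x - v y)"
  proof (rule gap_ge)
    show "u xs - v xs - \<zeta> \<beta> xs xs \<le> u x - v y - \<zeta> \<beta> xs x - n * d (x, y)"
      using max[of xs xs] i \<rho> unfolding g_def d_def B_def by simp
    show "n * d (x, y) \<ge> 0" using n unfolding d_def by simp
  qed
  ultimately show False using Q_pos by simp
qed

context
  fixes t0 K :: real
  assumes t0: "t0 > 0" and K: "K > 0"
    "\<And>i z G g h. i \<in> J \<Longrightarrow> z \<in> \<P> i \<Longrightarrow> 0 < z \<bullet> e i \<Longrightarrow> z \<bullet> e i < t0 \<Longrightarrow> C1_fun G g \<Longrightarrow>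
       touching i (\<lambda>y. u y - G y) z \<Longrightarrow> proj i h = h \<Longrightarrow> \<bar>g z \<bullet> h\<bar> \<le> K * norm h"
begin

text \<open>A second penalty \<open>n'\<close> on the difference of heights frees the normal
  variables. No bound on \<open>n'\<close> is available, but its gradients cancel in
  \<open>G' - H'\<close>; what remains of \<open>G'\<close> meets only a difference of velocities,
  which costs at most \<open>K * (L * r)\<close>.\<close>

lemma no_doubled_maximum_interior:
  assumes i: "i \<in> J" and x: "x \<in> \<P> i" "0 < x \<bullet> e i" and xy: "y - x \<in> \<Gamma>" and n: "n > 0"
    and r0: "r0 > 0" "dist x xs + r0 < min \<rho>0 t0" "norm (x - y) + r0 < r"
    and r: "\<And>t. 0 \<le> t \<Longrightarrow> t < r \<Longrightarrow> \<omega> t \<le> Q / 4" "K * (L * r) \<le> Q / 8"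
    and max: "\<And>x' y'. x' \<in> \<P> i \<inter> ball x r0 \<Longrightarrow> y' \<in> \<P> i \<inter> ball y r0 \<Longrightarrow> y' - x' \<in> \<Gamma> \<Longrightarrow>
      u x' - v y' - \<zeta> \<beta> xs x' - n * (norm (x' - y'))\<^sup>2 \<le> u x - v y - \<zeta> \<beta> xs x - n * (norm (x - y))\<^sup>2"
    and val: "Q \<le> lam * (u x - v y - \<zeta> \<beta> xs x - n * (norm (x - y))\<^sup>2)"
  shows False
proof -
  have ne: "norm (e i) = 1" using i by (simp add: norm_eq_1)
  have n0: "norm (e 0) = 1" by (simp add: norm_eq_1)
  have yi: "y \<bullet> e i = x \<bullet> e i" using interface_inner[OF i xy] by (simp add: inner_diff_left)
  have y: "y \<in> \<P> i"
  proof -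
    have "proj i (y - x) = y - x" using interface_halfplane[OF xy] i mem_halfplane by blast
    then show ?thesis using x i yi by (simp add: mem_halfplane proj_diff)
  qed
  define \<rho> where "\<rho> = min (x \<bullet> e i) r0 / 2"
  have \<rho>: "\<rho> > 0" "\<rho> < r0" "\<rho> < x \<bullet> e i" unfolding \<rho>_def using x r0 by auto
  define B where "B p = \<P> i \<inter> cball p \<rho>" for p
  have B: "x' \<in> \<P> i" "x' \<bullet> e i > 0" if "x' \<in> B p" "p \<bullet> e i = x \<bullet> e i" for x' p
  proof -
    show "x' \<in> \<P> i" using that unfolding B_def by blast
    have "(p - x') \<bullet> e i \<le> norm (p - x')" using norm_cauchy_schwarz[of "p - x'" "e i"] ne by simp
    also have "\<dots> \<le> \<rho>" using that unfolding B_def by (simp add: dist_norm)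
    finally show "x' \<bullet> e i > 0" using \<rho>(3) that by (simp add: inner_diff_left)
  qed
  have Bx: "x' \<in> \<P> i" "x' \<bullet> e i > 0" if "x' \<in> B x" for x' using B[OF that] by auto
  have By: "y' \<in> \<P> i" "y' \<bullet> e i > 0" if "y' \<in> B y" for y' using B[OF that yi] by auto
  have BS: "B p \<subseteq> \<S>" for p unfolding B_def using halfplane_subset[OF i] by blast
  have cB: "compact (B p)" for p
    unfolding B_def using closed_halfplane[OF i] compact_cball closed_Int_compact by blast
  \<comment> \<open>At equal heights the tangential penalty is the full squared distance. The two
    added squares make \<open>(x, y)\<close> a strict maximum among such pairs.\<close>
  define Z where "Z z = \<zeta> \<beta> xs (fst z) + (n * ((fst z - snd z) \<bullet> e 0)\<^sup>2 +
    ((norm (fst z - x))\<^sup>2 + (norm (snd z - y))\<^sup>2))" for z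
  define g where "g z = u (fst z) - v (snd z) - Z z" for z
  define d where "d z = ((fst z - snd z) \<bullet> e i)\<^sup>2" for z
  \<comment> \<open>The added squares contribute a gradient of norm at most
    \<open>4 * \<epsilon>\<close>, hence at most \<open>Q / 8\<close> against a velocity bounded by
    \<open>M\<close>.\<close>
  define \<epsilon> where "\<epsilon> = min \<rho> (min (r0 / 2) (Q / (32 * M)))"
  have \<epsilon>: "\<epsilon> > 0" unfolding \<epsilon>_def using \<rho> r0 Q_pos M_pos by simp
  have \<epsilon>': "\<epsilon> \<le> \<rho>" "\<epsilon> \<le> r0 / 2" "\<epsilon> \<le> Q / (32 * M)" unfolding \<epsilon>_def by auto
  have gxy: "g (x, y) = u x - v y - \<zeta> \<beta> xs x - n * (norm (x - y))\<^sup>2"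
  proof -
    have "x - y = ((x - y) \<bullet> e 0) *\<^sub>R e 0"
      using xy mem_interface[of "y - x"] by (simp add: inner_diff_left) (metis minus_diff_eq scaleR_minus_left)
    then have "norm (x - y) = \<bar>(x - y) \<bullet> e 0\<bar>" using n0 by (metis mult.right_neutral norm_scaleR)
    then show ?thesis unfolding g_def Z_def by simp
  qed
  have "\<exists>n'>0. \<exists>z\<in>B x \<times> B y. (\<forall>w\<in>B x \<times> B y. g w - n' * d w \<le> g z - n' * d z) \<and>
      dist z (x, y) < \<epsilon> \<and> n' * d z < \<epsilon>"
  proof (rule penalized_maximum)
    show "compact (B x \<times> B y)" by (intro compact_Times cB)
    show "(x, y) \<in> B x \<times> B y" unfolding B_def using x y \<rho> by simp
    show "d (x, y) = 0" unfolding d_def by (simp add: inner_diff_left yi)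
    show "continuous_on (B x \<times> B y) d" unfolding d_def by (intro continuous_intros)
    show "d z \<ge> 0" for z unfolding d_def by simp
    show "eventually (\<lambda>w. g w < c) (at z within B x \<times> B y)" if "z \<in> B x \<times> B y" "g z < c" for z c
      using that BS unfolding g_def by (intro doubling_usc) (auto simp: Z_def intro!: continuous_intros)
    show "g z < g (x, y)" if z: "z \<in> B x \<times> B y" "d z = 0" "z \<noteq> (x, y)" for z
    proof -
      obtain x' y' where z': "z = (x', y')" by (cases z)
      have P: "x' \<in> \<P> i" "y' \<in> \<P> i" using Bx By z z' by auto
      have "(y' - x') \<bullet> e i = 0" using z(2) unfolding z' d_def by (simp add: inner_diff_left)
      moreover have "proj i (y' - x') = y' - x'" using P i by (simp add: mem_halfplane proj_diff)
      ultimately have eq: "y' - x' = ((y' - x') \<bullet> e 0) *\<^sub>R e 0" unfolding proj_def by simp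
      then have G: "y' - x' \<in> \<Gamma>" using mem_interface by blast
      have "norm (y' - x') = \<bar>(y' - x') \<bullet> e 0\<bar>" using eq n0 by (metis mult.right_neutral norm_scaleR)
      then have nn: "(norm (x' - y'))\<^sup>2 = ((x' - y') \<bullet> e 0)\<^sup>2"
        by (simp add: norm_minus_commute inner_diff_left power2_commute)
      have "u x' - v y' - \<zeta> \<beta> xs x' - n * (norm (x' - y'))\<^sup>2 \<le> g (x, y)"
        unfolding gxy using P z z' \<rho>(2) G by (intro max) (auto simp: B_def)
      moreover have "(norm (x' - x))\<^sup>2 + (norm (y' - y))\<^sup>2 > 0"
        using z(3) unfolding z' by (auto simp: add_nonneg_pos add_pos_nonneg)
      ultimately show ?thesis unfolding z' g_def[of "(x', y')"] Z_def nn by simp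
    qed
  qed (rule \<epsilon>)
  then obtain n' x' y' where n': "n' > 0" and x'y': "x' \<in> B x" "y' \<in> B y" "dist (x', y') (x, y) < \<epsilon>"
    and max': "\<And>x'' y''. x'' \<in> B x \<Longrightarrow> y'' \<in> B y \<Longrightarrow> g (x'', y'') - n' * d (x'', y'') \<le> g (x', y') - n' * d (x', y')"
    by auto
  have dx: "dist x' x < \<epsilon>" "dist y' y < \<epsilon>"
    using x'y'(3) dist_fst_le[of "(x', y')" "(x, y)"] dist_snd_le[of "(x', y')" "(x, y)"] by auto
  define G where "G p = \<zeta> \<beta> xs p + (n * ((p - y') \<bullet> e 0)\<^sup>2 +
    ((norm (p - x))\<^sup>2 + n' * ((p - y') \<bullet> e i)\<^sup>2))" for p
  define H where "H p = (- n) * ((p - x') \<bullet> e 0)\<^sup>2 +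
    ((-1) * (norm (p - y))\<^sup>2 + (- n') * ((p - x') \<bullet> e i)\<^sup>2)" for p
  define G' where "G' p = \<zeta>' \<beta> xs p + (n *\<^sub>R ((2 * ((p - y') \<bullet> e 0)) *\<^sub>R e 0) +
    (2 *\<^sub>R (p - x) + n' *\<^sub>R ((2 * ((p - y') \<bullet> e i)) *\<^sub>R e i)))" for p
  define H' where "H' p = (- n) *\<^sub>R ((2 * ((p - x') \<bullet> e 0)) *\<^sub>R e 0) +
    ((-1) *\<^sub>R (2 *\<^sub>R (p - y)) + (- n') *\<^sub>R ((2 * ((p - x') \<bullet> e i)) *\<^sub>R e i))" for p
  have near: "\<P> i \<inter> ball q (\<rho> - dist q p) \<subseteq> B p" for p q
  proof
    fix w assume w: "w \<in> \<P> i \<inter> ball q (\<rho> - dist q p)"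
    then show "w \<in> B p" unfolding B_def using dist_triangle[of p w q] by (simp add: dist_commute)
  qed
  have flip: "((a - b) \<bullet> c)\<^sup>2 = ((b - a) \<bullet> c)\<^sup>2" for a b c :: "real^3"
    by (simp add: inner_diff_left power2_commute)
  have touch: "touching i (\<lambda>p. u p - G p) x'"
    unfolding touching_def
  proof (intro exI[of _ "\<rho> - dist x' x"] conjI ballI)
    show "u p - G p \<le> u x' - G x'" if "p \<in> \<P> i \<inter> ball x' (\<rho> - dist x' x)" for p
      using max'[OF subsetD[OF near that] x'y'(2)] unfolding g_def Z_def d_def G_def by simp
  qed (use dx \<epsilon>' in simp)
  have touch': "touching i (\<lambda>p. H p - v p) y'"
    unfolding touching_def
  proof (intro exI[of _ "\<rho> - dist y' y"] conjI ballI)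
    show "H p - v p \<le> H y' - v y'" if "p \<in> \<P> i \<inter> ball y' (\<rho> - dist y' y)" for p
      using max'[OF x'y'(1) subsetD[OF near that]] unfolding g_def Z_def d_def H_def
      by (simp add: flip[of x'])
  qed (use dx \<epsilon>' in simp)
  have C1: "C1_fun G G'" "C1_fun H H'"
    unfolding G_def G'_def H_def H'_def by (intro C1_fun_intros C1_fun_\<zeta>)+
  note P = Bx[OF x'y'(1)] By[OF x'y'(2)]
  obtain a where a: "a \<in> A i"
      "lam * (u x' - v y') \<le> G' x' \<bullet> f i x' a - H' y' \<bullet> f i y' a + \<omega> (norm (x' - y'))"
    using doubling_estimate[OF i P C1 touch touch'] by blast
  have xs0: "xs \<bullet> e i = 0" using interface_inner[OF i maximum_in_interface] .
  have dxs: "dist x' xs < min \<rho>0 t0" using dist_triangle[of x' xs x] dx \<epsilon>' r0 by simp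
  have nxy: "norm (x' - y') < r"
  proof -
    have "norm (x' - y') \<le> norm (x' - x) + norm (x - y) + norm (y - y')"
      using norm_triangle_ineq[of "x' - x" "x - y"] norm_triangle_ineq[of "x' - y" "y - y'"] by simp
    also have "\<dots> < r" using dx \<epsilon>' r0 by (simp add: dist_norm norm_minus_commute)
    finally show ?thesis .
  qed
  have "x' \<bullet> e i = (x' - xs) \<bullet> e i" by (simp add: inner_diff_left xs0)
  also have "\<dots> \<le> norm (x' - xs)" using norm_cauchy_schwarz[of "x' - xs" "e i"] ne by simp
  also have "\<dots> < t0" using dxs by (simp add: dist_norm)
  finally have t: "x' \<bullet> e i < t0" .
  \<comment> \<open>The full gradient of the test function for \<open>u\<close> is paired only with
    the difference of velocities, where \<open>K\<close> applies.\<close>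
  have split: "G' x' \<bullet> f i x' a - H' y' \<bullet> f i y' a
      = G' x' \<bullet> (f i x' a - f i y' a) + (G' x' - H' y') \<bullet> f i y' a"
    by (simp add: inner_diff_left inner_diff_right)
  have diff: "G' x' - H' y' = \<zeta>' \<beta> xs x' + 2 *\<^sub>R ((x' - x) + (y' - y))"
    unfolding G'_def H'_def by (simp add: inner_diff_left algebra_simps)
  have lip: "G' x' \<bullet> (f i x' a - f i y' a) \<le> Q / 8"
  proof -
    have "G' x' \<bullet> (f i x' a - f i y' a) \<le> K * norm (f i x' a - f i y' a)"
      using K(2)[OF i P(1,2) t C1(1) touch, of "f i x' a - f i y' a"] f_plane i P a by (simp add: proj_diff)
    also have "\<dots> \<le> K * (L * norm (x' - y'))" using f_lip[OF i P(1,3) a(1)] K(1) by simp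
    also have "\<dots> \<le> K * (L * r)" using K(1) L_pos nxy by simp
    finally show ?thesis using r(2) by simp
  qed
  have drift: "(\<zeta>' \<beta> xs x' + 2 *\<^sub>R ((x' - x) + (y' - y))) \<bullet> f i y' a \<le> Q / 4 + Q / 8"
  proof -
    have "norm (\<zeta>' \<beta> xs x' + 2 *\<^sub>R ((x' - x) + (y' - y))) \<le> norm (\<zeta>' \<beta> xs x') + 2 * (norm (x' - x) + norm (y' - y))"
      using norm_triangle_ineq[of "\<zeta>' \<beta> xs x'" "2 *\<^sub>R ((x' - x) + (y' - y))"]
        norm_triangle_ineq[of "x' - x" "y' - y"] by simp
    also have "\<dots> \<le> norm (\<zeta>' \<beta> xs x') + 4 * (Q / (32 * M))"
      using dx \<epsilon>'(3) by (simp add: dist_norm)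
    finally have *: "norm (\<zeta>' \<beta> xs x' + 2 *\<^sub>R ((x' - x) + (y' - y))) \<le> norm (\<zeta>' \<beta> xs x') + 4 * (Q / (32 * M))" .
    have "(\<zeta>' \<beta> xs x' + 2 *\<^sub>R ((x' - x) + (y' - y))) \<bullet> f i y' a
        \<le> norm (\<zeta>' \<beta> xs x' + 2 *\<^sub>R ((x' - x) + (y' - y))) * norm (f i y' a)"
      by (rule norm_cauchy_schwarz)
    also have "\<dots> \<le> (norm (\<zeta>' \<beta> xs x') + 4 * (Q / (32 * M))) * M"
      using * f_bound[OF i P(3) a(1)] Q_pos M_pos by (intro mult_mono) auto
    also have "\<dots> = M * norm (\<zeta>' \<beta> xs x') + Q / 8" using M_pos by (simp add: field_simps)
    also have "\<dots> \<le> Q / 4 + Q / 8" using \<rho>0(2)[of x'] dxs by simp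
    finally show ?thesis .
  qed
  have "\<omega> (norm (x' - y')) \<le> Q / 4" using r(1) nxy by simp
  then have "lam * (u x' - v y') \<le> 3 * Q / 4"
    using a(2) lip drift unfolding split diff by linarith
  moreover have "Q \<le> lam * (u x' - v y')"
  proof -
    have "g (x, y) - n' * d (x, y) \<le> g (x', y') - n' * d (x', y')"
      using x y \<rho> by (intro max') (auto simp: B_def)
    moreover have "d (x, y) = 0" unfolding d_def by (simp add: inner_diff_left yi)
    moreover have "n' * d (x', y') \<ge> 0" "Z (x', y') \<ge> 0"
      unfolding d_def Z_def \<zeta>_def using n n' \<beta> by auto
    ultimately have "u x - v y - \<zeta> \<beta> xs x - n * (norm (x - y))\<^sup>2 \<le> u x' - v y'"
      unfolding gxy[symmetric] g_def[of "(x', y')"] by simp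
    then show ?thesis using val lam_pos by (meson less_imp_le mult_left_mono order_trans)
  qed
  ultimately show False using Q_pos by simp
qed

text \<open>The budget: \<open>3 * Q / 16\<close> from the three terms of
  \<open>interface_rate\<close>, \<open>Q / 4\<close> and \<open>Q / 16\<close> from the first and
  second order terms of \<open>\<zeta>\<close>, together the rate error \<open>Q / 2\<close>; then
  \<open>Q / 4\<close> as the \<open>\<kappa>\<close> of \<open>interface_slope\<close>.\<close>

lemma no_doubled_maximum_interface:
  assumes x: "x \<in> \<Gamma>" and y: "y \<in> \<Gamma>" and n: "n > 0"
    and r0: "r0 > 0" "dist x xs < \<rho>0" "norm (x - y) + r0 < r"
    and r: "\<And>t. 0 \<le> t \<Longrightarrow> t < r \<Longrightarrow> \<omega> t \<le> Q / 16" "K * (L * r) \<le> Q / 16"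
    and max: "\<And>i x' y'. i \<in> J \<Longrightarrow> x' \<in> \<P> i \<inter> ball x r0 \<Longrightarrow> y' \<in> \<P> i \<inter> ball y r0 \<Longrightarrow> y' - x' \<in> \<Gamma> \<Longrightarrow>
      u x' - v y' - \<zeta> \<beta> xs x' - n * (norm (x' - y'))\<^sup>2 \<le> u x - v y - \<zeta> \<beta> xs x - n * (norm (x - y))\<^sup>2"
    and val: "Q \<le> lam * (u x - v y)"
  shows False
proof -
  define p0 where "p0 = 2 * n * ((x - y) \<bullet> e 0)"
  have xP: "x \<in> \<P> i" and yP: "y \<in> \<P> i" for i using x y by (auto intro: interface_halfplane)
  have rate: "\<exists>\<eta>0>0. \<forall>\<eta>\<in>{0..\<eta>0}. (u x - \<zeta> \<beta> xs x) - (u (x + \<eta> *\<^sub>R f i y a) - \<zeta> \<beta> xs (x + \<eta> *\<^sub>R f i y a))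
        \<le> (l i y a - lam * u x + Q / 2) * \<eta>"
    if i: "i \<in> J" and a: "a \<in> A i" "f i y a \<bullet> e i \<ge> 0" for i a
  proof -
    obtain r1 where r1: "r1 > 0"
        "\<And>z. z \<in> \<P> i \<Longrightarrow> dist z x < r1 \<Longrightarrow> dist (u z) (u x) < Q / (16 * lam)"
      using u_cont_halfplane[OF i, unfolded continuous_on_iff, rule_format, OF xP, of "Q / (16 * lam)"]
        Q_pos lam_pos by auto
    define \<rho> where "\<rho> = min r1 (min r0 t0)"
    have \<rho>: "\<rho> > 0" "\<rho> \<le> r1" "\<rho> \<le> r0" "\<rho> \<le> t0" unfolding \<rho>_def using r1 r0 t0 by auto
    have "\<exists>\<eta>0>0. \<forall>\<eta>\<in>{0..\<eta>0}.
        u x - u (x + \<eta> *\<^sub>R f i y a) \<le> (l i y a - lam * u x + 3 * Q / 16) * \<eta>"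
    proof (rule interface_rate[OF i x y a K(1) _ \<rho>(1)])
      show "\<bar>g z \<bullet> h\<bar> \<le> K * norm h" if "z \<in> \<P> i" "0 < z \<bullet> e i" "z \<bullet> e i < \<rho>" "C1_fun G g"
        "touching i (\<lambda>y. u y - G y) z" "proj i h = h" for z G g h
        using K(2)[OF i that(1,2) _ that(4-6)] that(3) \<rho>(4) by simp
      fix z assume z: "z \<in> \<P> i" "z \<in> ball x \<rho>"
      have "norm (z - y) \<le> norm (z - x) + norm (x - y)" using norm_triangle_ineq[of "z - x" "x - y"] by simp
      also have "\<dots> < r" using z(2) \<rho>(3) r0(3) by (simp add: dist_norm norm_minus_commute)
      finally have nr: "norm (z - y) < r" .
      have "K * (L * norm (z - y)) \<le> K * (L * r)" using nr K(1) L_pos by simp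
      moreover have "lam * \<bar>u z - u x\<bar> \<le> lam * (Q / (16 * lam))"
        using r1(2)[OF z(1)] z(2) \<rho>(2) lam_pos
        by (intro mult_left_mono) (auto simp: dist_real_def dist_commute)
      moreover have "lam * (Q / (16 * lam)) = Q / 16" using lam_pos by simp
      ultimately show "\<omega> (norm (z - y)) + K * (L * norm (z - y)) + lam * \<bar>u z - u x\<bar> \<le> 3 * Q / 16"
        using r(1)[OF _ nr] r(2) by simp
    qed
    then obtain \<eta>0 where \<eta>0: "\<eta>0 > 0" "\<And>\<eta>. \<eta> \<in> {0..\<eta>0} \<Longrightarrow>
        u x - u (x + \<eta> *\<^sub>R f i y a) \<le> (l i y a - lam * u x + 3 * Q / 16) * \<eta>" by blast
    \<comment> \<open>The second entry bounds the quadratic term of \<open>\<zeta>\<close> by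
      \<open>\<eta> * (Q / 16)\<close>.\<close>
    define \<eta>1 where "\<eta>1 = min \<eta>0 (Q / (16 * ((\<beta> + 1) * M\<^sup>2)))"
    show ?thesis
    proof (intro exI[of _ \<eta>1] conjI ballI)
      show "\<eta>1 > 0" unfolding \<eta>1_def using \<eta>0 Q_pos \<beta> M_pos by simp
      fix \<eta> assume "\<eta> \<in> {0..\<eta>1}"
      then have \<eta>: "0 \<le> \<eta>" "\<eta> \<le> \<eta>0" "\<eta> \<le> Q / (16 * ((\<beta> + 1) * M\<^sup>2))" unfolding \<eta>1_def by auto
      have fM: "norm (f i y a) \<le> M" using f_bound[OF i yP a(1)] .
      have "\<zeta>' \<beta> xs x \<bullet> f i y a \<le> norm (\<zeta>' \<beta> xs x) * norm (f i y a)" by (rule norm_cauchy_schwarz)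
      also have "\<dots> \<le> norm (\<zeta>' \<beta> xs x) * M" using fM by (intro mult_left_mono) auto
      also have "\<dots> \<le> Q / 4" using \<rho>0(2)[OF r0(2)] by (simp add: mult.commute)
      finally have 1: "\<eta> * (\<zeta>' \<beta> xs x \<bullet> f i y a) \<le> \<eta> * (Q / 4)" using \<eta>(1) by (rule mult_left_mono)
      have "(\<beta> + 1) * \<eta> * (norm (f i y a))\<^sup>2 \<le> (\<beta> + 1) * \<eta> * M\<^sup>2"
        using fM \<beta> \<eta> by (intro mult_left_mono power_mono) auto
      also have "\<dots> = \<eta> * ((\<beta> + 1) * M\<^sup>2)" by simp
      also have "\<dots> \<le> Q / (16 * ((\<beta> + 1) * M\<^sup>2)) * ((\<beta> + 1) * M\<^sup>2)"
        using \<eta>(3) \<beta> by (intro mult_right_mono) auto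
      also have "\<dots> = Q / 16" using \<beta> M_pos by simp
      finally have "\<eta> * ((\<beta> + 1) * \<eta> * (norm (f i y a))\<^sup>2) \<le> \<eta> * (Q / 16)" using \<eta>(1) by (rule mult_left_mono)
      then have "(\<beta> + 1) * \<eta>\<^sup>2 * (norm (f i y a))\<^sup>2 \<le> \<eta> * (Q / 16)" by (simp add: power2_eq_square mult_ac)
      then have "u x - \<zeta> \<beta> xs x - (u (x + \<eta> *\<^sub>R f i y a) - \<zeta> \<beta> xs (x + \<eta> *\<^sub>R f i y a))
          \<le> (l i y a - lam * u x + 3 * Q / 16) * \<eta> + \<eta> * (Q / 4) + \<eta> * (Q / 16)"
      proof -
        have "u x - u (x + \<eta> *\<^sub>R f i y a) \<le> (l i y a - lam * u x + 3 * Q / 16) * \<eta>"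
          using \<eta>0(2)[of \<eta>] \<eta> by simp
        with 1 \<open>(\<beta> + 1) * \<eta>\<^sup>2 * (norm (f i y a))\<^sup>2 \<le> \<eta> * (Q / 16)\<close>
        show ?thesis unfolding \<zeta>_expand by linarith
      qed
      also have "\<dots> = (l i y a - lam * u x + Q / 2) * \<eta>" by (simp add: field_simps)
      finally show "u x - \<zeta> \<beta> xs x - (u (x + \<eta> *\<^sub>R f i y a) - \<zeta> \<beta> xs (x + \<eta> *\<^sub>R f i y a))
          \<le> (l i y a - lam * u x + Q / 2) * \<eta>" .
    qed
  qed
  have "\<exists>r. touching i (\<lambda>y'. p0 * ((y' - y) \<bullet> e 0) + ((- 2 * n) * ((y' - y) \<bullet> e 0)\<^sup>2 +
        r * ((y' - y) \<bullet> e i)) - v y') y \<and>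
      (\<forall>a\<in>A i. f i y a \<bullet> e i \<ge> 0 \<longrightarrow>
        lam * u x - l i y a - Q / 2 - Q / 4 - p0 * (f i y a \<bullet> e 0) \<le> r * (f i y a \<bullet> e i))"
    if i: "i \<in> J" for i
  proof (rule interface_slope[OF i x y n _ r0(1) rate[OF i] max[OF i] p0_def])
    show "Q / 4 > 0" using Q_pos by simp
  qed
  from bchoice[OF ballI[OF this]] obtain s where
    "\<forall>i\<in>J. touching i (\<lambda>y'. p0 * ((y' - y) \<bullet> e 0) + ((- 2 * n) * ((y' - y) \<bullet> e 0)\<^sup>2 +
        s i * ((y' - y) \<bullet> e i)) - v y') y \<and>
      (\<forall>a\<in>A i. f i y a \<bullet> e i \<ge> 0 \<longrightarrow>
        lam * u x - l i y a - Q / 2 - Q / 4 - p0 * (f i y a \<bullet> e 0) \<le> s i * (f i y a \<bullet> e i))"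
    by (rule exE)
  note s = bspec[OF this, THEN conjunct1] bspec[OF this, THEN conjunct2, THEN bspec, THEN mp]
  \<comment> \<open>The slopes \<open>s i\<close> are unrelated, but only the normal term depends on
    \<open>i\<close> and it vanishes on \<open>\<Gamma>\<close>, so the functions glue.\<close>
  define G where "G i y' = p0 * ((y' - y) \<bullet> e 0) + ((- 2 * n) * ((y' - y) \<bullet> e 0)\<^sup>2 +
        s i * ((y' - y) \<bullet> e i))" for i y'
  define G' where "G' i y' = p0 *\<^sub>R e 0 + ((- 2 * n) *\<^sub>R ((2 * ((y' - y) \<bullet> e 0)) *\<^sub>R e 0) +
        s i *\<^sub>R e i)" for i y'
  have "\<exists>i\<in>J. \<exists>a\<in>A i. f i y a \<bullet> e i \<ge> 0 \<and> lam * v y - G' i y \<bullet> f i y a - l i y a \<ge> 0"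
  proof (rule super_test_interface[OF y])
    show "C1_fun (G i) (G' i)" for i unfolding G_def G'_def by (intro C1_fun_intros)
    show "G i y' = G k y'" if "i \<in> J" "k \<in> J" "y' \<in> \<Gamma>" for i k y'
      using that y by (simp add: G_def inner_diff_left interface_inner)
    show "touching i (\<lambda>y'. G i y' - v y') y" if "i \<in> J" for i using s(1)[OF that] unfolding G_def .
  qed
  then obtain i a where ia: "i \<in> J" "a \<in> A i" "f i y a \<bullet> e i \<ge> 0"
      "lam * v y - G' i y \<bullet> f i y a - l i y a \<ge> 0" by blast
  have "G' i y \<bullet> f i y a = p0 * (f i y a \<bullet> e 0) + s i * (f i y a \<bullet> e i)"
    unfolding G'_def by (simp add: inner_add_right inner_commute[of _ "f i y a"])
  then have "lam * (u x - v y) \<le> 3 * Q / 4"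
    using s(2)[OF ia(1-3)] ia(4) by (simp add: right_diff_distrib)
  then show False using val Q_pos by simp
qed

text \<open>Since the two points differ by a vector of \<open>\<Gamma>\<close>, they are either both
  on the interface or both off it, and the two preceding lemmas cover these cases.\<close>

lemma no_interface_maximum: False
proof -
  obtain r where r: "r > 0" "\<And>t. 0 \<le> t \<Longrightarrow> t < r \<Longrightarrow> \<omega> t \<le> Q / 16"
    using \<omega>_small[of "Q / 16"] Q_pos by auto
  define r' where "r' = min r (Q / (16 * (K * L)))"
  have r': "r' > 0" "r' \<le> r" "K * (L * r') \<le> Q / 16"
  proof -
    show "r' > 0" "r' \<le> r" unfolding r'_def using r(1) Q_pos K(1) L_pos by auto
    have "K * L * r' \<le> K * L * (Q / (16 * (K * L)))" unfolding r'_def using K(1) L_pos by (intro mult_left_mono) auto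
    then show "K * (L * r') \<le> Q / 16" using K(1) L_pos by (simp add: mult.assoc)
  qed
  \<comment> \<open>The radius \<open>r0\<close> below equals \<open>\<epsilon>\<close>:
    \<open>1 / 2\<close> keeps the neighbourhoods in \<open>B\<close>, \<open>r' / 4\<close> bounds
    \<open>norm (x - y) + r0\<close>, and the last entry bounds
    \<open>dist x xs + r0\<close>.\<close>
  define \<epsilon> where "\<epsilon> = min (min (1 / 2) (r' / 4)) (min \<rho>0 t0 / 2)"
  have \<epsilon>: "\<epsilon> > 0" unfolding \<epsilon>_def using r' \<rho>0 t0 by simp
  have \<epsilon>': "\<epsilon> \<le> 1 / 2" "\<epsilon> \<le> r' / 4" "\<epsilon> \<le> min \<rho>0 t0 / 2" unfolding \<epsilon>_def by auto
  define B where "B = \<S> \<inter> cball xs 1"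
  define D where "D = (B \<times> B) \<inter> {z. snd z - fst z \<in> \<Gamma>}"
  define g where "g z = u (fst z) - v (snd z) - \<zeta> \<beta> xs (fst z)" for z
  define d where "d z = (norm (fst z - snd z))\<^sup>2" for z :: "(real^3) \<times> (real^3)"
  have DS: "D \<subseteq> \<S> \<times> \<S>" unfolding D_def B_def by auto
  have "\<exists>n>0. \<exists>z\<in>D. (\<forall>w\<in>D. g w - n * d w \<le> g z - n * d z) \<and> dist z (xs, xs) < \<epsilon> \<and> n * d z < \<epsilon>"
  proof (rule penalized_maximum)
    have "compact B" unfolding B_def using closed_ramified_space compact_cball closed_Int_compact by blast
    moreover have "closed ((\<lambda>z. snd z - fst z) -` \<Gamma>)"
      using closed_interface by (intro continuous_closed_vimage continuous_intros) auto
    then have "closed {z. snd z - fst z \<in> \<Gamma>}" by (simp add: vimage_def)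
    ultimately show "compact D" unfolding D_def by (intro compact_Int_closed compact_Times)
    have "0 \<in> \<Gamma>" unfolding interface_def by (rule span_zero)
    then show "(xs, xs) \<in> D" unfolding D_def B_def using xs by simp
    show "d (xs, xs) = 0" unfolding d_def by simp
    show "continuous_on D d" unfolding d_def by (intro continuous_intros)
    show "d z \<ge> 0" for z unfolding d_def by simp
    show "eventually (\<lambda>w. g w < c) (at z within D)" if "z \<in> D" "g z < c" for z c
      using that DS unfolding g_def by (intro doubling_usc continuous_intros) auto
    show "g z < g (xs, xs)" if z: "z \<in> D" "d z = 0" "z \<noteq> (xs, xs)" for z
    proof -
      have eq: "fst z = snd z" using z unfolding d_def by simp
      then have "(norm (fst z - xs))\<^sup>2 > 0" using z(3) by (cases z) auto
      moreover have "fst z \<in> \<S>" using z(1) DS by auto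
      then have "g z \<le> g (xs, xs) - (norm (fst z - xs))\<^sup>2"
        using diagonal_le[of "fst z"] eq unfolding g_def by simp
      ultimately show ?thesis by linarith
    qed
  qed (rule \<epsilon>)
  then obtain n x y where n: "n > 0" and xy: "(x, y) \<in> D" "dist (x, y) (xs, xs) < \<epsilon>"
    and max: "\<And>x' y'. (x', y') \<in> D \<Longrightarrow> g (x', y') - n * d (x', y') \<le> g (x, y) - n * d (x, y)"
    by auto
  have dx: "dist x xs < \<epsilon>" "dist y xs < \<epsilon>"
    using xy(2) dist_fst_le[of "(x, y)" "(xs, xs)"] dist_snd_le[of "(x, y)" "(xs, xs)"] by auto
  have nxy: "norm (x - y) < r' / 2"
    using dist_triangle[of x y xs] dx \<epsilon>' by (simp add: dist_norm norm_minus_commute)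
  have xS: "x \<in> \<S>" and yx: "y - x \<in> \<Gamma>" using xy(1) unfolding D_def B_def by auto
  define r0 where "r0 = \<epsilon>"
  have r0: "r0 > 0" "dist x xs + r0 < min \<rho>0 t0" "norm (x - y) + r0 < r'"
    unfolding r0_def using \<epsilon> \<epsilon>' dx nxy by auto
  have near: "p \<in> B" if "p \<in> \<P> i \<inter> ball q r0" "dist q xs < \<epsilon>" "i \<in> J" for p q i
    using that halfplane_subset[OF that(3)] dist_triangle[of xs p q] \<epsilon>'
    unfolding B_def r0_def by (auto simp: dist_commute)
  have max': "u x' - v y' - \<zeta> \<beta> xs x' - n * (norm (x' - y'))\<^sup>2 \<le> u x - v y - \<zeta> \<beta> xs x - n * (norm (x - y))\<^sup>2"
    if "i \<in> J" "x' \<in> \<P> i \<inter> ball x r0" "y' \<in> \<P> i \<inter> ball y r0" "y' - x' \<in> \<Gamma>" for i x' y'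
    using max[of x' y'] near[OF that(2) dx(1) that(1)] near[OF that(3) dx(2) that(1)] that(4)
    unfolding D_def g_def d_def by simp
  have base: "u xs - v xs - \<zeta> \<beta> xs xs \<le> u x - v y - \<zeta> \<beta> xs x - n * (norm (x - y))\<^sup>2"
  proof -
    have "0 \<in> \<Gamma>" unfolding interface_def by (rule span_zero)
    then have "(xs, xs) \<in> D" unfolding D_def B_def using xs by simp
    from max[OF this] show ?thesis unfolding g_def d_def by simp
  qed
  show False
  proof (cases "x \<in> \<Gamma>")
    case True
    have "y - x + x \<in> \<Gamma>" using yx True unfolding interface_def by (intro span_add)
    then have y: "y \<in> \<Gamma>" by simp
    show False
    proof (rule no_doubled_maximum_interface[OF True y n r0(1) _ r0(3) _ r'(3) max'])
      show "dist x xs < \<rho>0" using r0 by simp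
      show "\<omega> t \<le> Q / 16" if "0 \<le> t" "t < r'" for t using r(2) r'(2) that by simp
      show "Q \<le> lam * (u x - v y)" using gap_ge[OF base] n by simp
    qed
  next
    case False
    obtain i where i: "i \<in> J" "x \<in> \<P> i" using xS unfolding ramified_space_eq by blast
    have xi: "x \<bullet> e i > 0" using halfplane_interface[OF i] False i by (auto simp: mem_halfplane)
    show False
    proof (rule no_doubled_maximum_interior[OF i xi yx n r0 _ _ max'[OF i(1)]])
      show "\<omega> t \<le> Q / 4" if "0 \<le> t" "t < r'" for t using r(2)[of t] r'(2) that Q_pos by simp
      show "K * (L * r') \<le> Q / 8" using r'(3) Q_pos by simp
      have "\<mu> \<le> u x - v y - \<zeta> \<beta> xs x - n * (norm (x - y))\<^sup>2"
        using base xs_val unfolding \<zeta>_def by simp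
      then show "Q \<le> lam * (u x - v y - \<zeta> \<beta> xs x - n * (norm (x - y))\<^sup>2)"
        unfolding Q using lam_pos by simp
    qed
  qed
qed

end

end

section \<open>Choice of the penalization constants\<close>

theorem comparison:
  assumes x0: "x0 \<in> \<S>" shows "u x0 \<le> v x0"
proof (rule ccontr)
  assume neg: "\<not> u x0 \<le> v x0"
  \<comment> \<open>Half of the excess at \<open>x0\<close> survives, as the first entry of
    \<open>\<beta>\<close> limits the penalty there to \<open>\<mu>\<close>. The second gives
    \<open>\<beta> * norm xs \<le> q\<close>, because positivity at \<open>xs\<close> forces
    \<open>\<beta> * (norm xs)\<^sup>2 \<le> 2 * M\<close>. Finally \<open>q\<close> is chosen so
    that a gradient of norm at most \<open>4 * q\<close> costs \<open>Q / 4\<close> against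
    velocities bounded by \<open>M\<close>.\<close>
  define \<mu> where "\<mu> = (u x0 - v x0) / 2"
  define Q where "Q = lam * \<mu>"
  define q where "q = Q / (16 * M)"
  define \<beta> where "\<beta> = min (\<mu> / ((norm x0)\<^sup>2 + 1)) (q\<^sup>2 / (2 * M))"
  have \<mu>: "\<mu> > 0" unfolding \<mu>_def using neg by simp
  have Q: "Q > 0" unfolding Q_def using \<mu> lam_pos by simp
  have q: "q > 0" unfolding q_def using Q M_pos by simp
  have pos: "(norm x0)\<^sup>2 + 1 > 0" by (simp add: add_nonneg_pos)
  have \<beta>: "\<beta> > 0" unfolding \<beta>_def using \<mu> q M_pos pos by simp
  have \<beta>1: "\<beta> * (norm x0)\<^sup>2 \<le> \<mu>"
  proof -
    have "\<beta> * ((norm x0)\<^sup>2 + 1) \<le> \<mu>"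
      unfolding \<beta>_def using pos by (simp add: min_le_iff_disj flip: pos_le_divide_eq)
    then show ?thesis using \<beta> by (simp add: algebra_simps)
  qed
  have \<beta>2: "2 * M * \<beta> \<le> q\<^sup>2"
  proof -
    have "2 * M * \<beta> \<le> 2 * M * (q\<^sup>2 / (2 * M))" unfolding \<beta>_def using M_pos by (intro mult_left_mono) auto
    then show ?thesis using M_pos by simp
  qed
  define h where "h x = u x - v x - \<beta> * (norm x)\<^sup>2" for x
  have hx0: "h x0 \<ge> \<mu>" unfolding h_def using \<beta>1 \<mu>_def by (simp add: field_simps)
  have small: "\<beta> * (norm x)\<^sup>2 \<le> 2 * M" if "x \<in> \<S>" "h x > 0" for x
    using that(2) u_bound[OF that(1)] v_bound[OF that(1)] unfolding h_def by linarith
  have "\<exists>xs\<in>\<S>. h xs \<ge> \<mu> \<and> (\<forall>x\<in>\<S>. h x \<le> h xs)"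
  proof -
    define R where "R = sqrt (2 * M / \<beta>)"
    have inR: "norm x \<le> R" if "x \<in> \<S>" "h x > 0" for x
      unfolding R_def using small[OF that] \<beta> by (intro real_le_rsqrt) (simp add: field_simps)
    \<comment> \<open>Restricting to the diagonal lets \<open>doubling_usc\<close> supply the
      semicontinuity of \<open>u - v\<close>. Outside the ball of radius \<open>R\<close> the
      function \<open>h\<close> is not positive.\<close>
    define D where "D = (\<lambda>x. (x, x)) ` (\<S> \<inter> cball 0 R)"
    define H where "H z = u (fst z) - v (snd z) - \<beta> * (norm (fst z))\<^sup>2" for z
    have x0R: "x0 \<in> \<S> \<inter> cball 0 R" using inR[OF x0] hx0 \<mu> x0 by simp
    have "\<exists>z\<in>D. \<forall>w\<in>D. H w \<le> H z"
    proof (rule usc_attains_max)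
      have "compact (\<S> \<inter> cball 0 R)" using closed_ramified_space compact_cball closed_Int_compact by blast
      then show "compact D" unfolding D_def by (intro compact_continuous_image continuous_intros)
      show "D \<noteq> {}" unfolding D_def using x0R by blast
      show "eventually (\<lambda>w. H w < c) (at z within D)" if "z \<in> D" "H z < c" for z c
        using that unfolding H_def
        by (intro doubling_usc continuous_intros) (auto simp: D_def)
    qed
    then obtain z where z: "z \<in> D" "\<And>w. w \<in> D \<Longrightarrow> H w \<le> H z" by blast
    then obtain xs where xsD: "xs \<in> \<S> \<inter> cball 0 R" "z = (xs, xs)" unfolding D_def by blast
    have "h x \<le> h xs" if "x \<in> \<S> \<inter> cball 0 R" for x
      using z(2)[of "(x, x)"] that unfolding xsD(2) D_def H_def h_def by auto
    note xs = xsD(1) this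
    have hxs: "h xs \<ge> \<mu>" using xs(2)[OF x0R] hx0 by simp
    have "h x \<le> h xs" if "x \<in> \<S>" for x
      using xs(2)[of x] inR[OF that] that hxs \<mu> by (cases "h x > 0") auto
    then show ?thesis using xs(1) hxs by blast
  qed
  then obtain xs where xs: "xs \<in> \<S>" "h xs \<ge> \<mu>" "\<And>x. x \<in> \<S> \<Longrightarrow> h x \<le> h xs" by blast
  have bxs: "\<beta> * norm xs \<le> q"
  proof -
    have "(\<beta> * norm xs)\<^sup>2 = \<beta> * (\<beta> * (norm xs)\<^sup>2)" by (simp add: power2_eq_square)
    also have "\<dots> \<le> \<beta> * (2 * M)" using small[OF xs(1)] xs(2) \<mu> \<beta> by (intro mult_left_mono) auto
    also have "\<dots> \<le> q\<^sup>2" using \<beta>2 by (simp add: mult_ac)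
    finally show ?thesis using q by (auto intro: power2_le_imp_le)
  qed
  \<comment> \<open>Half of the bound \<open>4 * q\<close> is spent on the gradient at
    \<open>xs\<close>, the other half on its variation over this radius.\<close>
  define \<rho>0 where "\<rho>0 = q / (\<beta> + 1)"
  have \<rho>0: "\<rho>0 > 0" unfolding \<rho>0_def using q \<beta> by simp
  have grad: "M * norm (\<zeta>' \<beta> xs x) \<le> Q / 4" if "dist x xs < \<rho>0" for x
  proof -
    have "\<zeta>' \<beta> xs x = (2 * \<beta>) *\<^sub>R xs + (2 * (\<beta> + 1)) *\<^sub>R (x - xs)"
      unfolding \<zeta>'_def by (simp add: algebra_simps)
    then have "norm (\<zeta>' \<beta> xs x) \<le> 2 * (\<beta> * norm xs) + 2 * (\<beta> + 1) * norm (x - xs)"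
      using norm_triangle_ineq[of "(2 * \<beta>) *\<^sub>R xs" "(2 * (\<beta> + 1)) *\<^sub>R (x - xs)"] \<beta> by simp
    also have "2 * (\<beta> + 1) * norm (x - xs) \<le> 2 * (\<beta> + 1) * \<rho>0"
      using that \<beta> by (intro mult_left_mono) (auto simp: dist_norm)
    also have "2 * (\<beta> + 1) * \<rho>0 = 2 * q" unfolding \<rho>0_def using \<beta> by (simp add: field_simps)
    also have "2 * (\<beta> * norm xs) \<le> 2 * q" using bxs by simp
    finally have "norm (\<zeta>' \<beta> xs x) \<le> 4 * q" by simp
    then have "M * norm (\<zeta>' \<beta> xs x) \<le> M * (4 * q)" using M_pos by simp
    also have "\<dots> = Q / 4" unfolding q_def using M_pos by simp
    finally show ?thesis .
  qed
  obtain t0 K where tK: "t0 > 0" "K > 0"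
    "\<And>i z G g h. i \<in> J \<Longrightarrow> z \<in> \<P> i \<Longrightarrow> 0 < z \<bullet> e i \<Longrightarrow> z \<bullet> e i < t0 \<Longrightarrow> C1_fun G g \<Longrightarrow>
       touching i (\<lambda>y. u y - G y) z \<Longrightarrow> proj i h = h \<Longrightarrow> \<bar>g z \<bullet> h\<bar> \<le> K * norm h"
    using gradient_bound by blast
  show False
    by (rule no_interface_maximum[OF \<beta> \<mu> Q_def xs(1) _ _ \<rho>0 _ tK(1,2)])
      (fact xs(3)[unfolded h_def] xs(2)[unfolded h_def] grad tK(3))+
qed

end

theorem theorem2p5:
  fixes N :: nat
    and e :: "nat \<Rightarrow> real^3"
    and A :: "nat \<Rightarrow> 'a::metric_space set"
    and f :: "nat \<Rightarrow> real^3 \<Rightarrow> 'a \<Rightarrow> real^3"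
    and l :: "nat \<Rightarrow> real^3 \<Rightarrow> 'a \<Rightarrow> real"
    and lam :: real
    and u v :: "real^3 \<Rightarrow> real"
  assumes "ramified_frame N e"
    and "lam > 0"
    and "H0 N e A f" and "H1 N e A l" and "H2 N e A f l" and "H3 N e A f"
    and "bounded (u ` ramified_space N e)"
    and "continuous_on (ramified_space N e) u"
    and "viscosity_subsolution N e A f l lam u"
    and "bounded (v ` ramified_space N e)"
    and "viscosity_supersolution N e A f l lam v"
  shows "\<forall>x\<in>ramified_space N e. u x \<le> v x"
proof -
  interpret junction N e by unfold_locales (rule assms(1))
  obtain L where L: "L > 0" "\<And>i x y a. i \<in> J \<Longrightarrow> x \<in> \<P> i \<Longrightarrow> y \<in> \<P> i \<Longrightarrow> a \<in> A i \<Longrightarrow>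
      norm (f i x a - f i y a) \<le> L * norm (x - y)"
    using assms(3) unfolding H0_def J_def by blast
  obtain \<omega> where \<omega>: "modulus_of_continuity \<omega>" "\<And>i x y a. i \<in> J \<Longrightarrow> x \<in> \<P> i \<Longrightarrow> y \<in> \<P> i \<Longrightarrow> a \<in> A i \<Longrightarrow>
      \<bar>l i x a - l i y a\<bar> \<le> \<omega> (norm (x - y))"
    using assms(4) unfolding H1_def J_def by blast
  have "bounded (\<Union>i\<in>J. (\<lambda>(x, a). f i x a) ` (\<P> i \<times> A i))"
    using assms(3) unfolding H0_def J_def by (intro bounded_UN) auto
  then obtain Mf where Mf: "\<And>i x a. i \<in> J \<Longrightarrow> x \<in> \<P> i \<Longrightarrow> a \<in> A i \<Longrightarrow> norm (f i x a) \<le> Mf"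
    unfolding bounded_iff by fastforce
  have "bounded (\<Union>i\<in>J. (\<lambda>(x, a). l i x a) ` (\<P> i \<times> A i))"
    using assms(4) unfolding H1_def J_def by (intro bounded_UN) auto
  then obtain Ml where Ml: "\<And>i x a. i \<in> J \<Longrightarrow> x \<in> \<P> i \<Longrightarrow> a \<in> A i \<Longrightarrow> \<bar>l i x a\<bar> \<le> Ml"
    unfolding bounded_iff by fastforce
  obtain Mu where Mu: "\<And>x. x \<in> \<S> \<Longrightarrow> \<bar>u x\<bar> \<le> Mu" using assms(7) unfolding bounded_iff by auto
  obtain Mv where Mv: "\<And>x. x \<in> \<S> \<Longrightarrow> \<bar>v x\<bar> \<le> Mv" using assms(10) unfolding bounded_iff by auto
  define M where "M = max 1 (max (max Mf Ml) (max Mu Mv))"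
  have M: "M > 0" "Mf \<le> M" "Ml \<le> M" "Mu \<le> M" "Mv \<le> M" unfolding M_def by auto
  interpret junction_comparison N e A f l lam u v L M \<omega>
  proof unfold_locales
    show "norm (f i x a) \<le> M" if "i \<in> J" "x \<in> \<P> i" "a \<in> A i" for i x a
      using Mf[OF that] M by simp
    show "\<bar>l i x a\<bar> \<le> M" if "i \<in> J" "x \<in> \<P> i" "a \<in> A i" for i x a
      using Ml[OF that] M by simp
    show "\<bar>u x\<bar> \<le> M" "\<bar>v x\<bar> \<le> M" if "x \<in> \<S>" for x
      using Mu[OF that] Mv[OF that] M by simp_all
  qed (use assms L \<omega> M in \<open>simp_all\<close>)
  show ?thesis using comparison by blast
qed

end
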